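(* Let $r\ge 2$, let $F$ be a free group of rank $r$ with fixed basis $A$, and let $S_{n,r}$ be the number of size $n$ subgroups of $F$. Let $I_n$ be the number of partial injections from $\{1,\dots,n\}$ to itself. Then, as $n\to\infty$, $$S_{n,r}\sim \frac{I_n^r}{(n-1)!}\qquad\text{and}\qquad S_{n,r}\sim \frac{(2e)^{-r/2}}{\sqrt{2\pi}}\; e^{-(r-1)n+2r\sqrt n}\; n^{(r-1)n+\frac{r+2}{4}}.$$
   Context: An $A$-graph is a pair $\Gamma=(V,E)$ with $V$ finite and $E\subseteq V\times A\times V$ such that $(u,a,v),(u,a,v')\in E$ implies $v=v'$, and $(u,a,v),(u',a,v)\in E$ implies $u=u'$. It is connected if its underlying undirected graph is connected. A vertex is a leaf if it occurs at most once in the list of triples defining $E$ (a loop $(v,a,v)$ counts as two occurrences of $v$). Given a vertex $v$, $\Gamma$ is $v$-trim if no vertex $w\neq v$ is a leaf, and the pair $(\Gamma,v)$ is admissible if $\Gamma$ is connected and $v$-trim. By Stallings foldings, each finitely generated subgroup $H\le F(A)$ is represented by an admissible pair $(\Gamma,1)$ (with $1$ a designated vertex), unique up to isomorphism, called the graphical representation of $H$; $H$ is the set of reduced words over $A\sqcup A^{-1}$ labeling closed paths at the vertex $1$ (edges may be traversed backwards, reading the inverse letter). Conversely every admissible pair is the graphical representation of a unique finitely generated subgroup. The size of $H$ is the number of vertices of $\Gamma$; there are finitely many subgroups of each size. A partial injection from $\{1,\dots,n\}$ to itself is an injective map from a (possibly empty) subset of $\{1,\dots,n\}$ to $\{1,\dots,n\}$.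 *)

theory Defs
  imports "HOL-Algebra.Generated_Groups" "HOL-Library.Landau_Symbols" Complex_Main
begin

section \<open>The free group on a set, realised on reduced words\<close>

text \<open>The letter \<open>(a, True)\<close> stands for the generator \<open>a\<close>, and
  \<open>(a, False)\<close> for its formal inverse.\<close>

type_synonym 'a letter = "'a \<times> bool"
type_synonym 'a word = "'a letter list"

definition inv_letter :: "'a letter \<Rightarrow> 'a letter" where
  "inv_letter x = (fst x, \<not> snd x)"

definition reduced :: "'a word \<Rightarrow> bool" where
  "reduced w \<longleftrightarrow> successively (\<lambda>x y. y \<noteq> inv_letter x) w"

definition push :: "'a letter \<Rightarrow> 'a word \<Rightarrow> 'a word" where
  "push x w = (case w of [] \<Rightarrow> [x] | y # ys \<Rightarrow> if y = inv_letter x then ys else x # w)"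

definition reduce :: "'a word \<Rightarrow> 'a word" where
  "reduce w = foldr push w []"

definition free_group :: "'a set \<Rightarrow> 'a word monoid" where
  "free_group A =
    \<lparr>carrier = {w. reduced w \<and> set w \<subseteq> A \<times> UNIV},
     mult = (\<lambda>u v. reduce (u @ v)),
     one = []\<rparr>"

lemma inv_letter_simps [simp]:
  "inv_letter (inv_letter x) = x" "inv_letter x \<noteq> x" "x \<noteq> inv_letter x"
  "inv_letter x \<in> A \<times> UNIV \<longleftrightarrow> x \<in> A \<times> UNIV"
  by (cases x; auto simp: inv_letter_def)+

lemma reduced_Nil: "reduced []"
  by (simp add: reduced_def)

lemma reduced_Cons: "reduced (x # w) \<longleftrightarrow> reduced w \<and> (w \<noteq> [] \<longrightarrow> hd w \<noteq> inv_letter x)"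
  by (cases w) (auto simp: reduced_def)

lemma reduced_push: "reduced w \<Longrightarrow> reduced (push x w)"
  by (cases w) (auto simp: push_def reduced_Cons reduced_Nil)

lemma push_cancel: "reduced w \<Longrightarrow> push x (push (inv_letter x) w) = w"
  by (cases w) (auto simp: push_def reduced_Cons split: list.splits)

lemma reduced_foldr_push: "reduced v \<Longrightarrow> reduced (foldr push u v)"
  by (induction u) (auto intro: reduced_push)

lemma reduced_reduce: "reduced (reduce w)"
  unfolding reduce_def by (intro reduced_foldr_push reduced_Nil)

lemma reduce_id: "reduced w \<Longrightarrow> reduce w = w"
  unfolding reduce_def by (induction w) (auto simp: reduced_Cons push_def split: list.splits)

lemma reduce_append: "reduce (u @ v) = foldr push u (reduce v)"
  by (simp add: reduce_def)

lemma foldr_push_push: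
  assumes "reduced v" shows "foldr push (push x u) v = push x (foldr push u v)"
  using push_cancel[OF reduced_foldr_push[OF assms]] by (auto simp: push_def[of x u] split: list.splits)

lemma foldr_push_reduce: "reduced v \<Longrightarrow> foldr push (reduce u) v = foldr push u v"
  by (induction u) (auto simp: reduce_def foldr_push_push)

lemma reduce_append_reduce: "reduce (u @ reduce v) = reduce (u @ v)"
  by (simp add: reduce_append reduce_id reduced_reduce)

lemma reduce_reduce_append: "reduce (reduce u @ v) = reduce (u @ v)"
  by (simp add: reduce_append foldr_push_reduce reduced_reduce)

lemma set_foldr_push: "set (foldr push u v) \<subseteq> set u \<union> set v"
proof (induction u)
  case (Cons x u)
  have "set (push x w) \<subseteq> insert x (set w)" for w :: "'a word"
    by (cases w) (auto simp: push_def)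
  with Cons show ?case by fastforce
qed simp

lemma set_reduce: "set (reduce w) \<subseteq> set w"
  using set_foldr_push[of w "[]"] by (simp add: reduce_def)

lemma reduce_inverse: "reduce (map inv_letter (rev w) @ w) = []"
proof (induction w)
  case (Cons x w)
  have "push (inv_letter x) (push x (reduce w)) = reduce w"
    using push_cancel[OF reduced_reduce, of "inv_letter x"] by simp
  with Cons show ?case by (simp add: reduce_def)
qed (simp add: reduce_def)

lemma reduced_inverse: "reduced w \<Longrightarrow> reduced (map inv_letter (rev w))"
  unfolding reduced_def
  by (auto simp: successively_map successively_rev elim!: successively_mono)

lemma group_free_group: "group (free_group A)"
proof (rule groupI)
  fix u v w
  assume "u \<in> carrier (free_group A)" "v \<in> carrier (free_group A)" "w \<in> carrier (free_group A)"
  then show "u \<otimes>\<^bsub>free_group A\<^esub> v \<otimes>\<^bsub>free_group A\<^esub> w = u \<otimes>\<^bsub>free_group A\<^esub> (v \<otimes>\<^bsub>free_group A\<^esub> w)"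
    by (simp add: free_group_def reduce_reduce_append reduce_append_reduce)
next
  fix w assume "w \<in> carrier (free_group A)"
  then show "\<exists>v\<in>carrier (free_group A). v \<otimes>\<^bsub>free_group A\<^esub> w = \<one>\<^bsub>free_group A\<^esub>"
    by (intro bexI[of _ "map inv_letter (rev w)"])
       (auto simp: free_group_def reduce_inverse reduced_inverse inv_letter_def)
next
  fix u v assume "u \<in> carrier (free_group A)" "v \<in> carrier (free_group A)"
  then show "u \<otimes>\<^bsub>free_group A\<^esub> v \<in> carrier (free_group A)"
    using set_reduce[of "u @ v"] by (auto simp: free_group_def reduced_reduce)
qed (auto simp: free_group_def reduced_Nil reduce_id)

section \<open>Graphs labelled by the basis\<close>

definition A_graph :: "'a set \<Rightarrow> 'v set \<Rightarrow> ('v \<times> 'a \<times> 'v) set \<Rightarrow> bool" where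
  "A_graph A V E \<longleftrightarrow> finite V \<and> E \<subseteq> V \<times> A \<times> V \<and>
     (\<forall>u a v v'. (u, a, v) \<in> E \<and> (u, a, v') \<in> E \<longrightarrow> v = v') \<and>
     (\<forall>u u' a v. (u, a, v) \<in> E \<and> (u', a, v) \<in> E \<longrightarrow> u = u')"

definition connected_graph :: "'v set \<Rightarrow> ('v \<times> 'a \<times> 'v) set \<Rightarrow> bool" where
  "connected_graph V E \<longleftrightarrow>
     (\<forall>u\<in>V. \<forall>v\<in>V. (u, v) \<in> {(x, y). \<exists>a. (x, a, y) \<in> E \<or> (y, a, x) \<in> E}\<^sup>*)"

text \<open>Occurrences as a source and as a target are counted separately, so a loop at \<open>w\<close>
  contributes two. The edge set is finite, as \<open>card\<close> requires, whenever the basis is finite.\<close>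

definition leaf :: "('v \<times> 'a \<times> 'v) set \<Rightarrow> 'v \<Rightarrow> bool" where
  "leaf E w \<longleftrightarrow> card {(u, a, v) \<in> E. u = w} + card {(u, a, v) \<in> E. v = w} \<le> 1"

definition trim :: "'v set \<Rightarrow> ('v \<times> 'a \<times> 'v) set \<Rightarrow> 'v \<Rightarrow> bool" where
  "trim V E v \<longleftrightarrow> (\<forall>w\<in>V. w \<noteq> v \<longrightarrow> \<not> leaf E w)"

definition admissible :: "'a set \<Rightarrow> 'v set \<Rightarrow> ('v \<times> 'a \<times> 'v) set \<Rightarrow> 'v \<Rightarrow> bool" where
  "admissible A V E v \<longleftrightarrow> A_graph A V E \<and> v \<in> V \<and> connected_graph V E \<and> trim V E v"

text \<open>\<open>labels_path E u w v\<close>: the word \<open>w\<close> labels a path from \<open>u\<close> to \<open>v\<close>.\<close>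

inductive labels_path :: "('v \<times> 'a \<times> 'v) set \<Rightarrow> 'v \<Rightarrow> 'a word \<Rightarrow> 'v \<Rightarrow> bool"
  for E where
  empty: "labels_path E v [] v"
| forward: "(u, a, u') \<in> E \<Longrightarrow> labels_path E u' w v \<Longrightarrow> labels_path E u ((a, True) # w) v"
| backward: "(u', a, u) \<in> E \<Longrightarrow> labels_path E u' w v \<Longrightarrow> labels_path E u ((a, False) # w) v"

definition graphical_rep ::
    "'a set \<Rightarrow> 'a word set \<Rightarrow> 'v set \<Rightarrow> ('v \<times> 'a \<times> 'v) set \<Rightarrow> 'v \<Rightarrow> bool" where
  "graphical_rep A H V E v \<longleftrightarrow>
     admissible A V E v \<and> H = {w. reduced w \<and> labels_path E v w v}"

section \<open>Counting\<close>

definition fg_subgroup :: "'a set \<Rightarrow> 'a word set \<Rightarrow> bool" where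
  "fg_subgroup A H \<longleftrightarrow> subgroup H (free_group A) \<and>
     (\<exists>K. finite K \<and> K \<subseteq> carrier (free_group A) \<and> H = generate (free_group A) K)"

text \<open>Graphical representations are unique up to isomorphism and have finitely many vertices,
  so natural numbers suffice as vertices.\<close>

definition has_size :: "'a set \<Rightarrow> 'a word set \<Rightarrow> nat \<Rightarrow> bool" where
  "has_size A H n \<longleftrightarrow> (\<exists>(V :: nat set) E v. graphical_rep A H V E v \<and> card V = n)"

definition num_subgroups :: "'a set \<Rightarrow> nat \<Rightarrow> nat" where
  "num_subgroups A n = card {H. fg_subgroup A H \<and> has_size A H n}"

definition num_partial_inj :: "nat \<Rightarrow> nat" where
  "num_partial_inj n =
     card {f :: nat \<rightharpoonup> nat. dom f \<subseteq> {1..n} \<and> ran f \<subseteq> {1..n} \<and> inj_on f (dom f)}"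

end

theory Submission
  imports "HOL-Analysis.Gamma_Function" "HOL-Real_Asymp.Real_Asymp" "HOL-Combinatorics.Permutations" Defs
begin

text \<open>Let \<open>I n\<close> be the number of partial injections of an \<open>n\<close>-element set. An \<open>A\<close>-graph on
  \<open>{1..n}\<close> is an \<open>r\<close>-tuple of partial injections, one for each label, so there are \<open>I n ^ r\<close> of them.
  The theorem rests on three facts.

  Every subgroup of size \<open>n\<close> is represented by exactly \<open>(n - 1)!\<close> admissible graphs on \<open>{1..n}\<close> with
  root \<open>1\<close> (\<open>card_rooted_graphs\<close>). An admissible graph is determined up to isomorphism by its subgroup:
  each of its edges lies on a reduced loop at the root (\<open>edge_on_reduced_loop\<close>), so it can be
  recovered from the labels of such loops (\<open>admissible_unique\<close>). It has no automorphism fixing the root,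
  since the endpoint of a path is determined by its label.

  Almost all \<open>A\<close>-graphs are admissible (\<open>rooted_graphs_ratio\<close>). A disconnected graph splits along a set
  of \<open>k \<le> n / 2\<close> vertices, and for \<open>r \<ge> 2\<close> the sum over \<open>k\<close> of
  \<open>(n choose k) * (I k * I (n - k) / I n) ^ r\<close> tends to \<open>0\<close>. A leaf is avoided by all labels but one, and by
  the last label on one side; this happens at a given vertex with probability \<open>o(1 / n)\<close>.

  Finally \<open>I n = n! * c n\<close> with \<open>c n = (\<Sum>j\<le>n. (n choose j) / j!)\<close>, and \<open>c n\<close> is asymptotically
  \<open>exp (2 * sqrt n - 1/2) / (2 * sqrt pi * n powr (1/4))\<close> (\<open>laguerre_asymp\<close>). Rewriting
  \<open>1 / (j!)^2\<close> as \<open>(2 * j choose j) / (2 * j)!\<close> turns the sum into an expectation over a Poisson variable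
  with mean \<open>2 * sqrt n\<close>, which Chebyshev's inequality localises at \<open>j = sqrt n\<close>. The
  second equivalence follows from this and Stirling's formula.\<close>

section \<open>Reading words along paths\<close>

text \<open>A letter is read forwards along an edge or, if it is a formal inverse, backwards. Treating both
  directions as one relation makes reversal of a path the same thing as inversion of its label.\<close>

definition edge :: "('v \<times> 'a \<times> 'v) set \<Rightarrow> 'v \<Rightarrow> 'a letter \<Rightarrow> 'v \<Rightarrow> bool" where
  "edge E u x v \<longleftrightarrow> (if snd x then (u, fst x, v) \<in> E else (v, fst x, u) \<in> E)"

abbreviation winv :: "'a word \<Rightarrow> 'a word" where
  "winv w \<equiv> map inv_letter (rev w)"

lemma edge_inv [simp]: "edge E u (inv_letter x) v \<longleftrightarrow> edge E v x u"
  by (auto simp: edge_def inv_letter_def)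

lemma inv_letter_eq_iff [simp]: "inv_letter x = inv_letter y \<longleftrightarrow> x = y"
  by (auto simp: inv_letter_def prod_eq_iff)

lemma labels_path_Nil [simp]: "labels_path E u [] v \<longleftrightarrow> u = v"
  by (auto intro: labels_path.intros elim: labels_path.cases)

lemma labels_path_Cons:
  "labels_path E u (x # w) v \<longleftrightarrow> (\<exists>u'. edge E u x u' \<and> labels_path E u' w v)"
proof
  assume "labels_path E u (x # w) v"
  then show "\<exists>u'. edge E u x u' \<and> labels_path E u' w v"
    by (cases rule: labels_path.cases) (auto simp: edge_def)
next
  assume "\<exists>u'. edge E u x u' \<and> labels_path E u' w v"
  then show "labels_path E u (x # w) v"
    by (cases x; cases "snd x") (auto simp: edge_def intro: labels_path.intros)
qed

lemma labels_path_append: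
  "labels_path E u (p @ q) v \<longleftrightarrow> (\<exists>m. labels_path E u p m \<and> labels_path E m q v)"
  by (induction p arbitrary: u) (auto simp: labels_path_Cons)

lemma labels_path_winv: "labels_path E u w v \<Longrightarrow> labels_path E v (winv w) u"
  by (induction w arbitrary: u) (auto simp: labels_path_Cons labels_path_append)

lemma edge_det: "A_graph A V E \<Longrightarrow> edge E u x v \<Longrightarrow> edge E u x v' \<Longrightarrow> v = v'"
  unfolding A_graph_def edge_def by (cases "snd x"; simp; metis)

lemma edge_det': "A_graph A V E \<Longrightarrow> edge E u x v \<Longrightarrow> edge E u' x v \<Longrightarrow> u = u'"
  using edge_det[of A V E v "inv_letter x" u u'] by simp

lemma edge_in: "A_graph A V E \<Longrightarrow> edge E u x v \<Longrightarrow> u \<in> V \<and> v \<in> V \<and> x \<in> A \<times> UNIV"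
  unfolding A_graph_def edge_def by (cases x) (auto split: if_splits)

lemma labels_path_in:
  "A_graph A V E \<Longrightarrow> labels_path E u w v \<Longrightarrow> u \<in> V \<Longrightarrow> v \<in> V \<and> set w \<subseteq> A \<times> UNIV"
  by (induction w arbitrary: u) (auto simp: labels_path_Cons dest!: edge_in)

lemma labels_path_det:
  "A_graph A V E \<Longrightarrow> labels_path E u w v \<Longrightarrow> labels_path E u w v' \<Longrightarrow> v = v'"
  by (induction w arbitrary: u) (auto simp: labels_path_Cons dest: edge_det)

text \<open>Cancelling \<open>x\<close> against \<open>inv_letter x\<close> does not move the endpoint: after reading both letters the
  path is back where it was, because at most one edge with a given label enters a vertex.\<close>

lemma labels_path_reduce:
  assumes "A_graph A V E" "labels_path E u w v" shows "labels_path E u (reduce w) v"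
  using assms(2)
proof (induction w arbitrary: u)
  case (Cons x w)
  then obtain u' where u': "edge E u x u'" "labels_path E u' (reduce w) v"
    by (auto simp: labels_path_Cons)
  have "labels_path E u (push x (reduce w)) v"
  proof (cases "reduce w")
    case (Cons y ys)
    show ?thesis
    proof (cases "y = inv_letter x")
      case True
      with Cons u' obtain u'' where "edge E u'' x u'" "labels_path E u'' ys v"
        by (auto simp: labels_path_Cons)
      moreover from this u' have "u'' = u" using edge_det'[OF assms(1)] by metis
      ultimately show ?thesis using Cons True by (simp add: push_def)
    next
      case False
      with Cons u' show ?thesis by (auto simp: push_def labels_path_Cons)
    qed
  qed (use u' in \<open>auto simp: push_def labels_path_Cons\<close>)
  then show ?case by (simp add: reduce_def)
qed (simp add: reduce_def)

lemma connected_graph_iff: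
  "connected_graph V E \<longleftrightarrow> (\<forall>u\<in>V. \<forall>v\<in>V. \<exists>w. labels_path E u w v)"
proof -
  let ?R = "{(x, y). \<exists>a. (x, a, y) \<in> E \<or> (y, a, x) \<in> E}"
  have R: "(u, v) \<in> ?R \<longleftrightarrow> (\<exists>x. edge E u x v)" for u v
  proof -
    have "(\<exists>x. edge E u x v) \<longleftrightarrow> (\<exists>a. edge E u (a, True) v \<or> edge E u (a, False) v)"
      by (metis (full_types) surj_pair)
    then show ?thesis by (auto simp: edge_def)
  qed
  have "(u, v) \<in> ?R\<^sup>* \<longleftrightarrow> (\<exists>w. labels_path E u w v)" for u v
  proof
    assume "(u, v) \<in> ?R\<^sup>*"
    then show "\<exists>w. labels_path E u w v"
    proof (induction rule: converse_rtrancl_induct)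
      case base show ?case by (rule exI[of _ "[]"]) simp
    next
      case (step y z)
      then obtain x w where "edge E y x z" "labels_path E z w v" using R by blast
      then have "labels_path E y (x # w) v" by (auto simp: labels_path_Cons)
      then show ?case by blast
    qed
  next
    assume "\<exists>w. labels_path E u w v"
    then obtain w where "labels_path E u w v" ..
    then show "(u, v) \<in> ?R\<^sup>*"
    proof (induction w arbitrary: u)
      case (Cons x w)
      then obtain m where "edge E u x m" "(m, v) \<in> ?R\<^sup>*" by (auto simp: labels_path_Cons)
      with R show ?case by (meson converse_rtrancl_into_rtrancl)
    qed simp
  qed
  then show ?thesis by (simp add: connected_graph_def)
qed

lemma admissible_reaches: "admissible A V E b \<Longrightarrow> u \<in> V \<Longrightarrow> \<exists>w. labels_path E b w u"
  unfolding admissible_def connected_graph_iff by blast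

section \<open>The subgroup read off at the root is finitely generated\<close>

definition loop_words :: "('v \<times> 'a \<times> 'v) set \<Rightarrow> 'v \<Rightarrow> 'a word set" where
  "loop_words E b = {w. reduced w \<and> labels_path E b w b}"

lemma reduce_cancel: "reduce z = [] \<Longrightarrow> reduce (x @ z @ y) = reduce (x @ y)"
proof -
  assume z: "reduce z = []"
  have "reduce (z @ y) = reduce y"
    using reduce_reduce_append[of z y] z by simp
  then show ?thesis by (simp add: reduce_append)
qed

lemma reduce_inverse': "reduce (w @ winv w) = []"
  using reduce_inverse[of "winv w"] by (simp add: rev_map comp_def)

lemma free_group_mult: "reduce x \<otimes>\<^bsub>free_group A\<^esub> reduce y = reduce (x @ y)"
  by (simp add: free_group_def reduce_append_reduce reduce_reduce_append)

lemma free_group_inv: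
  assumes "set z \<subseteq> A \<times> UNIV"
  shows "inv\<^bsub>free_group A\<^esub> (reduce z) = reduce (winv z)"
proof -
  interpret group "free_group A" by (rule group_free_group)
  have z: "set (winv z) \<subseteq> A \<times> UNIV" using assms by (auto simp: inv_letter_def)
  show ?thesis
  proof (rule inv_equality)
    show "reduce (winv z) \<otimes>\<^bsub>free_group A\<^esub> reduce z = \<one>\<^bsub>free_group A\<^esub>"
      unfolding free_group_mult reduce_inverse by (simp add: free_group_def)
    show "reduce z \<in> carrier (free_group A)" "reduce (winv z) \<in> carrier (free_group A)"
      using assms z set_reduce[of z] set_reduce[of "winv z"]
      by (auto simp: free_group_def reduced_reduce simp del: set_map set_rev)
  qed
qed

lemma subgroup_loop_words:
  assumes "A_graph A V E" "b \<in> V"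
  shows "subgroup (loop_words E b) (free_group A)"
proof -
  interpret group "free_group A" by (rule group_free_group)
  show ?thesis
  proof (rule subgroupI)
    show "loop_words E b \<subseteq> carrier (free_group A)"
      using labels_path_in[OF assms(1) _ assms(2)] by (auto simp: loop_words_def free_group_def)
    have "[] \<in> loop_words E b" by (simp add: loop_words_def reduced_Nil)
    then show "loop_words E b \<noteq> {}" by blast
  next
    fix w assume w: "w \<in> loop_words E b"
    have "inv\<^bsub>free_group A\<^esub> (reduce w) = reduce (winv w)"
      using w labels_path_in[OF assms(1) _ assms(2)] by (intro free_group_inv) (auto simp: loop_words_def)
    moreover have "reduce w = w" using w by (simp add: reduce_id loop_words_def)
    ultimately show "inv\<^bsub>free_group A\<^esub> w \<in> loop_words E b"
      using w labels_path_reduce[OF assms(1) labels_path_winv] by (auto simp: loop_words_def reduced_reduce)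
  next
    fix u w assume "u \<in> loop_words E b" "w \<in> loop_words E b"
    then have "labels_path E b (u @ w) b" by (auto simp: loop_words_def labels_path_append)
    then show "u \<otimes>\<^bsub>free_group A\<^esub> w \<in> loop_words E b"
      using labels_path_reduce[OF assms(1)] by (simp add: loop_words_def free_group_def reduced_reduce)
  qed
qed

lemma A_graph_finite_edges: "finite A \<Longrightarrow> A_graph A V E \<Longrightarrow> finite E"
  unfolding A_graph_def by (meson finite_SigmaI finite_subset)

text \<open>Choose for each vertex \<open>u\<close> a word \<open>p u\<close> leading there from the root. The generators are the loops
  that go to \<open>u\<close>, cross one edge \<open>(u, a, v)\<close> and return from \<open>v\<close>; along any path, the word
  \<open>p u @ w @ winv (p t)\<close> telescopes into a product of these loops and their inverses.\<close>

lemma fg_subgroup_loop_words: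
  assumes "finite A" and G: "A_graph A V E" and b: "b \<in> V" and conn: "connected_graph V E"
  shows "fg_subgroup A (loop_words E b)"
proof -
  let ?F = "free_group A"
  interpret group ?F by (rule group_free_group)
  have sub: "subgroup (loop_words E b) ?F" by (rule subgroup_loop_words[OF G b])
  obtain p0 where p0: "\<And>u. u \<in> V \<Longrightarrow> labels_path E b (p0 u) u"
    using conn b unfolding connected_graph_iff by metis
  \<comment> \<open>The empty word at the root, so that a loop at the root is not conjugated.\<close>
  define p where "p = p0(b := [])"
  have p: "labels_path E b (p u) u" if "u \<in> V" for u
    using p0[OF that] by (simp add: p_def)
  define gen where "gen = (\<lambda>(u, a, v). reduce (p u @ [(a, True)] @ winv (p v)))"
  have EV: "u \<in> V \<and> a \<in> A \<and> v \<in> V" if "(u, a, v) \<in> E" for u a v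
    using that G by (auto simp: A_graph_def)
  have gen_in: "gen ` E \<subseteq> loop_words E b"
  proof safe
    fix u a v assume e: "(u, a, v) \<in> E"
    have "edge E u (a, True) v" using e by (simp add: edge_def)
    then have "labels_path E b (p u @ [(a, True)] @ winv (p v)) b"
      using p EV[OF e] labels_path_winv[OF p[of v]]
      by (auto simp: labels_path_append labels_path_Cons)
    then show "gen (u, a, v) \<in> loop_words E b"
      using labels_path_reduce[OF G] by (simp add: gen_def loop_words_def reduced_reduce)
  qed
  have key: "reduce (p u @ w @ winv (p t)) \<in> generate ?F (gen ` E)" if "labels_path E u w t" for u w t
    using that
  proof (induction rule: labels_path.induct)
    case (empty v)
    have "\<one>\<^bsub>?F\<^esub> \<in> generate ?F (gen ` E)" by (rule generate.one)
    then show ?case by (simp only: append_Nil reduce_inverse') (simp add: free_group_def)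
  next
    case (forward u a u' w v)
    have "gen (u, a, u') \<in> generate ?F (gen ` E)" using forward by (intro generate.incl) auto
    then have "reduce (p u @ [(a, True)] @ winv (p u')) \<in> generate ?F (gen ` E)" by (simp add: gen_def)
    from generate.eng[OF this forward.IH]
    have "reduce ((p u @ [(a, True)]) @ (winv (p u') @ p u') @ w @ winv (p v)) \<in> generate ?F (gen ` E)"
      by (simp only: free_group_mult append_assoc)
    also have "reduce ((p u @ [(a, True)]) @ (winv (p u') @ p u') @ w @ winv (p v))
       = reduce ((p u @ [(a, True)]) @ w @ winv (p v))"
      by (rule reduce_cancel, rule reduce_inverse)
    finally show ?case by simp
  next
    case (backward u' a u w v)
    have pin: "set (p v) \<subseteq> A \<times> UNIV" if "v \<in> V" for v
      using labels_path_in[OF G p b] that by blast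
    have "inv\<^bsub>?F\<^esub> gen (u', a, u) \<in> generate ?F (gen ` E)" using backward by (intro generate.inv) auto
    also have "inv\<^bsub>?F\<^esub> gen (u', a, u) = reduce (winv (p u' @ [(a, True)] @ winv (p u)))"
      unfolding gen_def prod.case
      by (rule free_group_inv) (use pin EV[OF backward.hyps(1)] in \<open>fastforce simp: inv_letter_def\<close>)
    also have "winv (p u' @ [(a, True)] @ winv (p u)) = p u @ [(a, False)] @ winv (p u')"
      by (simp add: rev_map comp_def) (simp add: inv_letter_def)
    finally have "reduce (p u @ [(a, False)] @ winv (p u')) \<in> generate ?F (gen ` E)" .
    from generate.eng[OF this backward.IH]
    have "reduce ((p u @ [(a, False)]) @ (winv (p u') @ p u') @ w @ winv (p v)) \<in> generate ?F (gen ` E)"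
      by (simp only: free_group_mult append_assoc)
    also have "reduce ((p u @ [(a, False)]) @ (winv (p u') @ p u') @ w @ winv (p v))
       = reduce ((p u @ [(a, False)]) @ w @ winv (p v))"
      by (rule reduce_cancel, rule reduce_inverse)
    finally show ?case by simp
  qed
  have "loop_words E b \<subseteq> generate ?F (gen ` E)"
  proof
    fix w assume "w \<in> loop_words E b"
    then have "labels_path E b w b" "reduce w = w" by (auto simp: loop_words_def reduce_id)
    with key[OF this(1)] show "w \<in> generate ?F (gen ` E)" by (simp add: p_def)
  qed
  moreover have "generate ?F (gen ` E) \<subseteq> loop_words E b"
    by (rule generate_subgroup_incl[OF gen_in sub])
  ultimately have "loop_words E b = generate ?F (gen ` E)" by blast
  moreover have "finite (gen ` E)" using A_graph_finite_edges[OF assms(1) G] by simp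
  moreover have "gen ` E \<subseteq> carrier ?F" using gen_in subgroup.subset[OF sub] by blast
  ultimately show ?thesis using sub unfolding fg_subgroup_def by blast
qed

section \<open>Edges of admissible graphs lie on reduced loops\<close>

text \<open>The last argument records the vertices visited so far.\<close>

inductive simple_path :: "('v \<times> 'a \<times> 'v) set \<Rightarrow> 'v \<Rightarrow> 'a word \<Rightarrow> 'v \<Rightarrow> 'v set \<Rightarrow> bool"
  for E b where
  start: "simple_path E b [] b {b}"
| extend: "simple_path E b w u S \<Longrightarrow> edge E u x v \<Longrightarrow> v \<notin> S \<Longrightarrow> simple_path E b (w @ [x]) v (insert v S)"

lemma simple_path_labels: "simple_path E b w u S \<Longrightarrow> labels_path E b w u \<and> u \<in> S \<and> b \<in> S"
  by (induction rule: simple_path.induct) (auto simp: labels_path_append labels_path_Cons)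

lemma simple_path_prefix:
  "simple_path E b w u S \<Longrightarrow> m \<in> S \<Longrightarrow> \<exists>p q T. w = p @ q \<and> simple_path E b p m T"
proof (induction rule: simple_path.induct)
  case start
  then show ?case using simple_path.start by fastforce
next
  case (extend w u S x v)
  show ?case
  proof (cases "m = v")
    case True
    with simple_path.extend[OF extend.hyps] show ?thesis by (intro exI[of _ "w @ [x]"] exI[of _ "[]"]) auto
  next
    case False
    with extend obtain p q T where "w = p @ q" "simple_path E b p m T" by auto
    then show ?thesis by (intro exI[of _ p] exI[of _ "q @ [x]"] exI[of _ T]) auto
  qed
qed

lemma simple_path_visited:
  assumes "A_graph A V E"
  shows "simple_path E b w u S \<Longrightarrow> w = p @ q \<Longrightarrow> labels_path E b p m \<Longrightarrow> m \<in> S \<and> (q \<noteq> [] \<longrightarrow> m \<noteq> u)"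
proof (induction arbitrary: p q rule: simple_path.induct)
  case (extend w u S x v)
  note path = simple_path_labels[OF simple_path.extend[OF extend.hyps]]
  show ?case
  proof (cases q rule: rev_cases)
    case Nil
    with extend.prems path show ?thesis using labels_path_det[OF assms] by fastforce
  next
    case (snoc q' y)
    with extend.prems have "w = p @ q'" by auto
    with extend have "m \<in> S" by blast
    with extend.hyps show ?thesis by auto
  qed
qed auto

lemma reduced_snoc: "reduced (w @ [x]) \<longleftrightarrow> reduced w \<and> (w \<noteq> [] \<longrightarrow> last w \<noteq> inv_letter x)"
  by (auto simp: reduced_def successively_append_iff)

lemma reduced_append:
  "reduced (u @ w) \<longleftrightarrow> reduced u \<and> reduced w \<and> (u \<noteq> [] \<longrightarrow> w \<noteq> [] \<longrightarrow> hd w \<noteq> inv_letter (last u))"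
  by (auto simp: reduced_def successively_append_iff)

text \<open>A cancellation would step back to the vertex just left, which has already been visited.\<close>

lemma simple_path_reduced:
  assumes "A_graph A V E"
  shows "simple_path E b w u S \<Longrightarrow> reduced w"
proof (induction rule: simple_path.induct)
  case (extend w u S x v)
  show ?case unfolding reduced_snoc
  proof (intro conjI impI extend.IH notI)
    assume "w \<noteq> []" "last w = inv_letter x"
    then obtain w' where w': "w = w' @ [inv_letter x]" by (metis append_butlast_last_id)
    with simple_path_labels[OF extend.hyps(1)] obtain m where "labels_path E b w' m" "edge E u x m"
      by (auto simp: labels_path_append labels_path_Cons)
    with extend.hyps edge_det[OF assms] have "labels_path E b w' v" by metis
    from simple_path_visited[OF assms extend.hyps(1) w' this] extend.hyps show False by simp
  qed
qed (simp add: reduced_Nil)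

lemma ex_simple_path:
  assumes "labels_path E b w u"
  shows "\<exists>p S. simple_path E b p u S"
  using assms
proof (induction w arbitrary: u rule: rev_induct)
  case Nil
  then show ?case using simple_path.start by force
next
  case (snoc x w)
  then obtain m where m: "labels_path E b w m" "edge E m x u"
    by (auto simp: labels_path_append labels_path_Cons)
  with snoc.IH obtain p S where p: "simple_path E b p m S" by blast
  show ?case
  proof (cases "u \<in> S")
    case True with simple_path_prefix[OF p] show ?thesis by blast
  next
    case False with simple_path.extend[OF p m(2)] show ?thesis by blast
  qed
qed

text \<open>Contrapositive use: at a vertex that is not a leaf, at least two letters can be read (a loop
  provides both its label and the inverse), so a reduced path arriving there can be continued.\<close>

lemma leaf_if_unique_letter:
  assumes G: "A_graph A V E" and z: "\<And>y m. edge E v y m \<Longrightarrow> y = z"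
  shows "leaf E v"
proof -
  obtain a s where as: "z = (a, s)" by (cases z)
  have out: "(v, c, m) \<in> E \<Longrightarrow> s \<and> c = a" for c m using z[of "(c, True)" m] by (auto simp: edge_def as)
  have inc: "(m, c, v) \<in> E \<Longrightarrow> \<not> s \<and> c = a" for c m using z[of "(c, False)" m] by (auto simp: edge_def as)
  let ?O = "{(u, a, t) \<in> E. u = v}" and ?I = "{(u, a, t) \<in> E. t = v}"
  show ?thesis
  proof (cases s)
    case True
    have I: "?I = {}" using inc True by auto
    have "card ?O \<le> 1"
    proof (cases "?O = {}")
      case False
      then obtain c t where "(v, c, t) \<in> E" by auto
      with out have t: "(v, a, t) \<in> E" by metis
      then have "?O \<subseteq> {(v, a, t)}" using out G unfolding A_graph_def by blast
      from card_mono[OF _ this] show ?thesis by simp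
    qed (metis card.empty zero_le)
    then show ?thesis unfolding leaf_def I by simp
  next
    case False
    have O: "?O = {}" using out False by auto
    have "card ?I \<le> 1"
    proof (cases "?I = {}")
      case False
      then obtain c t where "(t, c, v) \<in> E" by auto
      with inc have t: "(t, a, v) \<in> E" by metis
      then have "?I \<subseteq> {(t, a, v)}" using inc G unfolding A_graph_def by blast
      from card_mono[OF _ this] show ?thesis by simp
    qed (metis card.empty zero_le)
    then show ?thesis unfolding leaf_def O by simp
  qed
qed

text \<open>Keep extending the path without backtracking; this is possible because vertices other than the root
  are not leaves. Since there are finitely many vertices, the path eventually hits a vertex \<open>v\<close> that
  it has visited before. It can then return to the root along its own initial segment up to \<open>v\<close>,
  reversed. No cancellation occurs at \<open>v\<close>: if both arrivals at \<open>v\<close> used the same letter, they would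
  come from the same vertex, which would then have been visited twice before.\<close>

lemma simple_path_closes:
  assumes adm: "admissible A V E b"
  shows "simple_path E b w u S \<Longrightarrow> edge E u x v \<Longrightarrow> reduced (w @ [x])
     \<Longrightarrow> \<exists>q. reduced (w @ [x] @ q) \<and> labels_path E v q b"
proof (induction "card (V - S)" arbitrary: w u S x v rule: less_induct)
  case less
  have G: "A_graph A V E" using adm by (simp add: admissible_def)
  show ?case
  proof (cases "v \<in> S")
    case True
    from simple_path_prefix[OF less.prems(1) this] obtain p q T
      where p: "w = p @ q" "simple_path E b p v T" by blast
    have pv: "labels_path E b p v" using simple_path_labels[OF p(2)] by simp
    have "last p \<noteq> x" if "p \<noteq> []"
    proof
      assume "last p = x"
      with that obtain p' where p': "p = p' @ [x]" by (metis append_butlast_last_id)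
      with pv obtain m where m: "labels_path E b p' m" "edge E m x v"
        by (auto simp: labels_path_append labels_path_Cons)
      then have "m = u" using edge_det'[OF G] less.prems(2) by metis
      with simple_path_visited[OF G less.prems(1), of p' "x # q" m] m p p' show False by simp
    qed
    moreover have "reduced (winv p)"
      using simple_path_reduced[OF G p(2)] by (rule reduced_inverse)
    ultimately have "reduced ((w @ [x]) @ winv p)"
      using less.prems(3) unfolding reduced_append[of "w @ [x]"] by (auto simp: hd_map hd_rev)
    with labels_path_winv[OF pv] show ?thesis by auto
  next
    case False
    have sp: "simple_path E b (w @ [x]) v (insert v S)"
      by (rule simple_path.extend[OF less.prems(1,2) False])
    have v: "v \<in> V" using edge_in[OF G less.prems(2)] by simp
    have "v \<noteq> b" using False simple_path_labels[OF less.prems(1)] by auto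
    with adm v have "\<not> leaf E v" by (auto simp: admissible_def trim_def)
    with leaf_if_unique_letter[OF G] obtain y m where y: "edge E v y m" "y \<noteq> inv_letter x" by metis
    have "card (V - insert v S) < card (V - S)"
      using G v False by (intro psubset_card_mono) (auto simp: A_graph_def)
    moreover have "reduced ((w @ [x]) @ [y])"
      using less.prems(3) y unfolding reduced_append[of "w @ [x]"] by (auto simp: reduced_def)
    ultimately obtain q where "reduced ((w @ [x]) @ [y] @ q)" "labels_path E m q b"
      using less.hyps[OF _ sp y(1)] by blast
    with y show ?thesis by (intro exI[of _ "y # q"]) (auto simp: labels_path_Cons)
  qed
qed

text \<open>Go to \<open>u\<close> along a simple path. Either appending \<open>x\<close> keeps it reduced, or the simple path
  itself ends by crossing the same edge in the opposite direction; both can be closed up.\<close>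

lemma edge_on_reduced_loop:
  assumes adm: "admissible A V E b" and e: "edge E u x v"
  obtains p q where "labels_path E b p u" "labels_path E v q b" "reduced (p @ [x] @ q)"
  | p q where "labels_path E b p v" "labels_path E u q b" "reduced (p @ [inv_letter x] @ q)"
proof -
  have G: "A_graph A V E" and b: "b \<in> V" and conn: "connected_graph V E"
    using adm by (auto simp: admissible_def)
  have "u \<in> V" using edge_in[OF G e] by simp
  with conn b obtain w where "labels_path E b w u" unfolding connected_graph_iff by blast
  from ex_simple_path[OF this] obtain p S where p: "simple_path E b p u S" by blast
  have red: "reduced p" by (rule simple_path_reduced[OF G p])
  show ?thesis
  proof (cases "reduced (p @ [x])")
    case True
    with simple_path_closes[OF adm p e] simple_path_labels[OF p] that(1) show ?thesis by blast
  next
    case False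
    with red have "p \<noteq> []" "last p = inv_letter x" by (auto simp: reduced_snoc)
    then obtain p' where p': "p = p' @ [inv_letter x]" by (metis append_butlast_last_id)
    from p show ?thesis
    proof cases
      case (extend w m S' y)
      then have "w = p'" "y = inv_letter x" using p' by auto
      with extend e edge_det'[OF G] have "simple_path E b p' v S'" by (metis edge_inv)
      from simple_path_closes[OF adm this, of "inv_letter x" u] e p' red
        simple_path_labels[OF this] that(2) show ?thesis by auto
    qed (use \<open>p \<noteq> []\<close> in simp)
  qed
qed

section \<open>Uniqueness of the graphical representation\<close>

definition map_edges :: "('v \<Rightarrow> 'w) \<Rightarrow> ('v \<times> 'a \<times> 'v) set \<Rightarrow> ('w \<times> 'a \<times> 'w) set" where
  "map_edges f E = (\<lambda>(u, a, v). (f u, a, f v)) ` E"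

text \<open>This relation is the isomorphism between two graphs with the same root subgroup: vertices
  correspond when some word leads to both of them. It need not be reduced.\<close>

definition co_reached :: "('v \<times> 'a \<times> 'v) set \<Rightarrow> 'v \<Rightarrow> ('w \<times> 'a \<times> 'w) set \<Rightarrow> 'w \<Rightarrow> 'v \<Rightarrow> 'w \<Rightarrow> bool" where
  "co_reached E b E' b' u u' \<longleftrightarrow> (\<exists>w. labels_path E b w u \<and> labels_path E' b' w u')"

lemma co_reached_sym: "co_reached E b E' b' u u' \<longleftrightarrow> co_reached E' b' E b u' u"
  by (auto simp: co_reached_def)

text \<open>If \<open>p\<close> and \<open>q\<close> both lead to \<open>u\<close>, then \<open>p @ winv q\<close> represents an element of the first subgroup, hence
  a loop in the second graph, and following that loop by \<open>q\<close> must end where \<open>p\<close> ends.\<close>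

lemma co_reached_functional:
  assumes G: "A_graph A V E" and G': "A_graph A V' E'"
    and sub: "loop_words E b \<subseteq> loop_words E' b'"
    and "co_reached E b E' b' u u1" "co_reached E b E' b' u u2"
  shows "u1 = u2"
proof -
  obtain p q where p: "labels_path E b p u" "labels_path E' b' p u1"
    and q: "labels_path E b q u" "labels_path E' b' q u2"
    using assms(4,5) by (auto simp: co_reached_def)
  have "labels_path E b (reduce (p @ winv q)) b"
    by (rule labels_path_reduce[OF G]) (use p(1) labels_path_winv[OF q(1)] in \<open>auto simp: labels_path_append\<close>)
  then have "reduce (p @ winv q) \<in> loop_words E b" by (simp add: loop_words_def reduced_reduce)
  with sub have "labels_path E' b' (reduce (p @ winv q)) b'" by (auto simp: loop_words_def)
  with q have "labels_path E' b' (reduce (p @ winv q) @ q) u2" by (auto simp: labels_path_append)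
  from labels_path_reduce[OF G' this]
  have "labels_path E' b' (reduce (p @ (winv q @ q))) u2"
    by (simp add: reduce_reduce_append)
  moreover have "reduce (p @ (winv q @ q)) = reduce p"
    using reduce_cancel[of "winv q @ q" p "[]"] by (simp add: reduce_inverse)
  ultimately show ?thesis using labels_path_det[OF G'] labels_path_reduce[OF G' p(2)] by metis
qed

text \<open>An edge is met by some reduced loop at the root. The label of that loop lies in the second
  subgroup, so it can be read in the second graph as well, where it crosses a corresponding edge.\<close>

lemma co_reached_edge:
  assumes adm: "admissible A V E b"
    and sub: "loop_words E b \<subseteq> loop_words E' b'" and e: "edge E u x v"
  shows "\<exists>u' v'. co_reached E b E' b' u u' \<and> co_reached E b E' b' v v' \<and> edge E' u' x v'"
proof -
  have *: "\<exists>u' v'. co_reached E b E' b' u u' \<and> co_reached E b E' b' v v' \<and> edge E' u' x v'"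
    if "labels_path E b p u" "labels_path E v q b" "reduced (p @ [x] @ q)" "edge E u x v" for p q u v x
  proof -
    have "p @ [x] @ q \<in> loop_words E b" using that by (auto simp: loop_words_def labels_path_append labels_path_Cons)
    with sub have "labels_path E' b' (p @ [x] @ q) b'" by (auto simp: loop_words_def)
    then obtain u' v' where uv: "labels_path E' b' p u'" "edge E' u' x v'"
      by (auto simp: labels_path_append labels_path_Cons)
    then have "labels_path E' b' (p @ [x]) v'" "labels_path E b (p @ [x]) v"
      using that by (auto simp: labels_path_append labels_path_Cons)
    with uv that show ?thesis unfolding co_reached_def by blast
  qed
  from edge_on_reduced_loop[OF adm e] show ?thesis
  proof cases
    case 1 with * e show ?thesis by blast
  next
    case (2 p q)
    with *[OF 2] e show ?thesis by auto
  qed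
qed

lemma co_reached_total:
  assumes adm: "admissible A V E b" and G': "A_graph A V' E'" and b': "b' \<in> V'"
    and sub: "loop_words E b \<subseteq> loop_words E' b'" and u: "u \<in> V"
  shows "\<exists>u'\<in>V'. co_reached E b E' b' u u'"
proof (cases "u = b")
  case True
  have "co_reached E b E' b' b b'" unfolding co_reached_def by (rule exI[of _ "[]"]) simp
  with True b' show ?thesis by blast
next
  case False
  obtain w where w: "labels_path E b w u"
    using admissible_reaches[OF adm u] by blast
  with False obtain w' x where "w = w' @ [x]" by (cases w rule: rev_cases) auto
  with w obtain m where "edge E m x u" by (auto simp: labels_path_append labels_path_Cons)
  from co_reached_edge[OF adm sub this] edge_in[OF G'] show ?thesis by blast
qed

lemma admissible_unique:
  assumes adm: "admissible A V E b" and adm': "admissible A V' E' b'"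
    and eq: "loop_words E b = loop_words E' b'"
  shows "\<exists>f. bij_betw f V V' \<and> f b = b' \<and> map_edges f E = E'"
proof -
  have G: "A_graph A V E" and G': "A_graph A V' E'" and b: "b \<in> V" and b': "b' \<in> V'"
    using adm adm' by (auto simp: admissible_def)
  define r where "r = co_reached E b E' b'"
  have r': "r u u' \<longleftrightarrow> co_reached E' b' E b u' u" for u u'
    unfolding r_def by (rule co_reached_sym)
  have fun1: "r u u1 \<Longrightarrow> r u u2 \<Longrightarrow> u1 = u2" for u u1 u2
    unfolding r_def by (rule co_reached_functional[OF G G']) (use eq in auto)
  have fun2: "r u1 u \<Longrightarrow> r u2 u \<Longrightarrow> u1 = u2" for u u1 u2
    unfolding r' by (rule co_reached_functional[OF G' G]) (use eq in auto)
  have tot1: "\<exists>u'\<in>V'. r u u'" if "u \<in> V" for u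
    unfolding r_def by (rule co_reached_total[OF adm G' b' _ that]) (use eq in auto)
  have tot2: "\<exists>u\<in>V. r u u'" if "u' \<in> V'" for u'
    unfolding r' by (rule co_reached_total[OF adm' G b _ that]) (use eq in auto)
  have edge1: "\<exists>u' v'. r u u' \<and> r v v' \<and> edge E' u' x v'" if "edge E u x v" for u x v
    unfolding r_def by (rule co_reached_edge[OF adm _ that]) (use eq in auto)
  have edge2: "\<exists>u v. r u u' \<and> r v v' \<and> edge E u x v" if "edge E' u' x v'" for u' x v'
    unfolding r' by (rule co_reached_edge[OF adm' _ that]) (use eq in auto)
  define f where "f u = (THE u'. r u u')" for u
  have f: "f u = u'" if "r u u'" for u u'
    unfolding f_def by (rule the_equality[where P = "r u", OF that]) (rule fun1[OF _ that])
  have "bij_betw f V V'"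
  proof (rule bij_betw_imageI)
    show "inj_on f V"
    proof (rule inj_onI)
      fix u v assume "u \<in> V" "v \<in> V" "f u = f v"
      with tot1[of u] tot1[of v] f fun2 show "u = v" by metis
    qed
    show "f ` V = V'"
    proof safe
      fix u assume "u \<in> V" with tot1[of u] f show "f u \<in> V'" by metis
    next
      fix u' assume "u' \<in> V'" with tot2[of u'] f show "u' \<in> f ` V" by (metis image_eqI)
    qed
  qed
  moreover have "r b b'" unfolding r_def co_reached_def by (rule exI[of _ "[]"]) simp
  then have "f b = b'" by (rule f)
  moreover have "map_edges f E = E'"
  proof safe
    fix u' a v' assume "(u', a, v') \<in> map_edges f E"
    then obtain u v where uv: "(u, a, v) \<in> E" "u' = f u" "v' = f v" by (auto simp: map_edges_def)
    with edge1[of u "(a, True)" v] f show "(u', a, v') \<in> E'" by (auto simp: edge_def)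
  next
    fix u' a v' assume "(u', a, v') \<in> E'"
    then obtain u v where uv: "r u u'" "r v v'" "(u, a, v) \<in> E"
      using edge2[of u' "(a, True)" v'] by (auto simp: edge_def)
    then have "(f u, a, f v) \<in> map_edges f E" unfolding map_edges_def by force
    then show "(u', a, v') \<in> map_edges f E" using f uv by simp
  qed
  ultimately show ?thesis by blast
qed

section \<open>Relabelling vertices and counting labellings\<close>

lemma edge_map_edges: "edge E u x v \<Longrightarrow> edge (map_edges f E) (f u) x (f v)"
  by (force simp: edge_def map_edges_def split: if_splits)

lemma labels_path_map_edges: "labels_path E u w v \<Longrightarrow> labels_path (map_edges f E) (f u) w (f v)"
  by (induction w arbitrary: u) (auto simp: labels_path_Cons dest: edge_map_edges[of _ _ _ _ f])

lemma map_edges_inv: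
  assumes "A_graph A V E" "inj_on f V"
  shows "map_edges (inv_into V f) (map_edges f E) = E"
proof -
  have "(\<lambda>e. (\<lambda>(u, a, v). (inv_into V f u, a, inv_into V f v)) ((\<lambda>(u, a, v). (f u, a, f v)) e)) ` E = (\<lambda>e. e) ` E"
    using assms by (intro image_cong) (auto simp: A_graph_def)
  then show ?thesis by (simp add: map_edges_def image_image)
qed

lemma loop_words_map_edges:
  assumes "A_graph A V E" "inj_on f V" "b \<in> V"
  shows "loop_words (map_edges f E) (f b) = loop_words E b"
proof -
  have "labels_path E b w b" if "labels_path (map_edges f E) (f b) w (f b)" for w
    using labels_path_map_edges[OF that, of "inv_into V f"] assms by (simp add: map_edges_inv)
  then show ?thesis using labels_path_map_edges[of E b _ b f] by (auto simp: loop_words_def)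
qed

lemma leaf_map_edges:
  assumes G: "A_graph A V E" and inj: "inj_on f V" and w: "w \<in> V"
  shows "leaf (map_edges f E) (f w) \<longleftrightarrow> leaf E w"
proof -
  let ?g = "\<lambda>(u, a, v). (f u, a, f v)"
  have inj': "inj_on ?g E"
    using inj G by (auto simp: inj_on_def A_graph_def)
  have *: "card {(u, a, v) \<in> map_edges f E. P' u a v} = card {(u, a, v) \<in> E. P u a v}"
    if "\<And>u a v. (u, a, v) \<in> E \<Longrightarrow> P' (f u) a (f v) \<longleftrightarrow> P u a v" for P P'
  proof -
    have "{(u, a, v) \<in> map_edges f E. P' u a v} = ?g ` {(u, a, v) \<in> E. P u a v}"
      using that unfolding map_edges_def by (auto simp: image_iff split: prod.splits) blast+
    also have "card \<dots> = card {(u, a, v) \<in> E. P u a v}"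
      by (intro card_image inj_on_subset[OF inj']) auto
    finally show ?thesis .
  qed
  have V: "(u, a, v) \<in> E \<Longrightarrow> u \<in> V \<and> v \<in> V" for u a v using G by (auto simp: A_graph_def)
  have 1: "card {(u, a, v) \<in> map_edges f E. u = f w} = card {(u, a, v) \<in> E. u = w}"
    by (rule *) (use V inj w in \<open>auto simp: inj_on_eq_iff\<close>)
  have 2: "card {(u, a, v) \<in> map_edges f E. v = f w} = card {(u, a, v) \<in> E. v = w}"
    by (rule *) (use V inj w in \<open>auto simp: inj_on_eq_iff\<close>)
  show ?thesis by (simp add: leaf_def 1 2)
qed

lemma A_graph_map_edges:
  assumes G: "A_graph A V E" and inj: "inj_on f V"
  shows "A_graph A (f ` V) (map_edges f E)"
proof -
  have V: "(u, a, v) \<in> E \<Longrightarrow> u \<in> V \<and> a \<in> A \<and> v \<in> V" for u a v using G by (auto simp: A_graph_def)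
  show ?thesis unfolding A_graph_def
  proof (intro conjI allI impI)
    show "finite (f ` V)" using G by (simp add: A_graph_def)
    show "map_edges f E \<subseteq> f ` V \<times> A \<times> f ` V" using V by (auto simp: map_edges_def)
  next
    fix u a v v' assume "(u, a, v) \<in> map_edges f E \<and> (u, a, v') \<in> map_edges f E"
    then obtain x y x' y' where "(x, a, y) \<in> E" "u = f x" "v = f y" "(x', a, y') \<in> E" "u = f x'" "v' = f y'"
      by (auto simp: map_edges_def)
    moreover from this have "x = x'" using inj_onD[OF inj, of x x'] V by metis
    ultimately show "v = v'" using G unfolding A_graph_def by metis
  next
    fix u u' a v assume "(u, a, v) \<in> map_edges f E \<and> (u', a, v) \<in> map_edges f E"
    then obtain x y x' y' where "(x, a, y) \<in> E" "u = f x" "v = f y" "(x', a, y') \<in> E" "u' = f x'" "v = f y'"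
      by (auto simp: map_edges_def)
    moreover from this have "y = y'" using inj_onD[OF inj, of y y'] V by metis
    ultimately show "u = u'" using G unfolding A_graph_def by metis
  qed
qed

lemma admissible_map_edges:
  assumes adm: "admissible A V E b" and inj: "inj_on f V"
  shows "admissible A (f ` V) (map_edges f E) (f b)"
proof -
  have G: "A_graph A V E" using adm by (simp add: admissible_def)
  have "connected_graph (f ` V) (map_edges f E)"
    using adm labels_path_map_edges[of E _ _ _ f] unfolding connected_graph_iff admissible_def by blast
  moreover have "trim (f ` V) (map_edges f E) (f b)"
    using adm leaf_map_edges[OF G inj] unfolding trim_def admissible_def by auto
  ultimately show ?thesis using adm A_graph_map_edges[OF G inj] by (auto simp: admissible_def)
qed

definition rooted_graphs :: "'a set \<Rightarrow> nat \<Rightarrow> (nat \<times> 'a \<times> nat) set set" where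
  "rooted_graphs A n = {E. admissible A {1..n} E 1}"

lemma finite_A_graphs: "finite A \<Longrightarrow> finite V \<Longrightarrow> finite {E. A_graph A V E}"
  by (rule finite_subset[of _ "Pow (V \<times> A \<times> V)"]) (auto simp: A_graph_def)

lemma finite_rooted_graphs: "finite A \<Longrightarrow> finite (rooted_graphs A n)"
  by (rule finite_subset[OF _ finite_A_graphs[of A "{1..n}"]]) (auto simp: rooted_graphs_def admissible_def)

text \<open>Finite generation holds for every admissible graph, so the size is the only constraint.\<close>

lemma subgroups_of_size:
  assumes "finite A" "n \<ge> 1"
  shows "{H. fg_subgroup A H \<and> has_size A H n} = (\<lambda>E. loop_words E 1) ` rooted_graphs A n"
proof safe
  fix H assume "has_size A H n"
  then obtain V E v where V: "admissible A (V :: nat set) E v" "H = loop_words E v" "card V = n"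
    by (auto simp: has_size_def graphical_rep_def loop_words_def)
  have fin: "finite V" and v: "v \<in> V" and G: "A_graph A V E" using V by (auto simp: admissible_def A_graph_def)
  obtain g where g: "bij_betw g V {1..n}"
    using finite_same_card_bij[OF fin, of "{1..n}"] V by auto
  define f where "f = Transposition.transpose (g v) 1 \<circ> g"
  have "g v \<in> {1..n}" using g v by (auto simp: bij_betw_def)
  then have "Transposition.transpose (g v) 1 permutes {1..n}" using assms by (intro permutes_swap_id) auto
  then have f: "bij_betw f V {1..n}" unfolding f_def by (intro bij_betw_trans[OF g] permutes_imp_bij)
  then have inj: "inj_on f V" and im: "f ` V = {1..n}" by (auto simp: bij_betw_def)
  have f1: "f v = 1" by (simp add: f_def)
  have "map_edges f E \<in> rooted_graphs A n"
    using admissible_map_edges[OF V(1) inj] by (simp add: rooted_graphs_def im f1)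
  moreover have "loop_words (map_edges f E) 1 = H"
    using loop_words_map_edges[OF G inj v] V f1 by simp
  ultimately show "H \<in> (\<lambda>E. loop_words E 1) ` rooted_graphs A n" by force
next
  fix E assume "E \<in> rooted_graphs A n"
  then have adm: "admissible A {1..n} E 1" by (simp add: rooted_graphs_def)
  then show "fg_subgroup A (loop_words E 1)"
    by (intro fg_subgroup_loop_words[OF assms(1)]) (auto simp: admissible_def)
  show "has_size A (loop_words E 1) n"
    unfolding has_size_def graphical_rep_def loop_words_def
    by (rule exI[of _ "{1..n}"], rule exI[of _ E], rule exI[of _ 1]) (use adm in simp)
qed

text \<open>Permutations fixing the root act on the labellings of one subgroup, transitively by uniqueness of
  the graph. The action is free: each vertex is the endpoint of some word read from the root, so an
  automorphism fixing the root is the identity.\<close>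

lemma card_labellings:
  assumes n: "n \<ge> 1" and E: "E \<in> rooted_graphs A n"
  shows "card {E' \<in> rooted_graphs A n. loop_words E' 1 = loop_words E 1} = fact (n - 1)"
proof -
  let ?V = "{1..n}"
  have adm: "admissible A ?V E 1" using E by (simp add: rooted_graphs_def)
  then have G: "A_graph A ?V E" by (simp add: admissible_def)
  have perm: "\<pi> permutes ?V" "\<pi> 1 = 1" if "\<pi> permutes {2..n}" for \<pi>
    using permutes_subset[OF that, of ?V] permutes_not_in[OF that, of 1] by auto
  have "bij_betw (\<lambda>\<pi>. map_edges \<pi> E) {\<pi>. \<pi> permutes {2..n}}
      {E' \<in> rooted_graphs A n. loop_words E' 1 = loop_words E 1}"
  proof (rule bij_betw_imageI)
    show "inj_on (\<lambda>\<pi>. map_edges \<pi> E) {\<pi>. \<pi> permutes {2..n}}"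
    proof (rule inj_onI)
      fix \<pi> \<sigma> assume "\<pi> \<in> {\<pi>. \<pi> permutes {2..n}}" "\<sigma> \<in> {\<pi>. \<pi> permutes {2..n}}"
        and eq: "map_edges \<pi> E = map_edges \<sigma> E"
      then have p: "\<pi> permutes {2..n}" "\<sigma> permutes {2..n}" by auto
      have "\<pi> u = \<sigma> u" if "u \<in> ?V" for u
      proof -
        obtain w where w: "labels_path E 1 w u"
          using admissible_reaches[OF adm \<open>u \<in> ?V\<close>] by blast
        from labels_path_map_edges[OF this, of \<pi>] labels_path_map_edges[OF this, of \<sigma>]
        have "labels_path (map_edges \<pi> E) 1 w (\<pi> u)" "labels_path (map_edges \<pi> E) 1 w (\<sigma> u)"
          using perm[OF p(1)] perm[OF p(2)] eq by auto
        moreover have "A_graph A (\<pi> ` ?V) (map_edges \<pi> E)"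
          by (rule A_graph_map_edges[OF G]) (use perm(1)[OF p(1)] in \<open>auto intro: permutes_inj_on\<close>)
        ultimately show ?thesis using labels_path_det by metis
      qed
      moreover have "\<pi> u = \<sigma> u" if "u \<notin> ?V" for u
        using that perm(1)[OF p(1)] perm(1)[OF p(2)] by (simp add: permutes_not_in)
      ultimately show "\<pi> = \<sigma>" by blast
    qed
    show "(\<lambda>\<pi>. map_edges \<pi> E) ` {\<pi>. \<pi> permutes {2..n}}
        = {E' \<in> rooted_graphs A n. loop_words E' 1 = loop_words E 1}" (is "?L = ?R")
    proof
      show "?L \<subseteq> ?R"
      proof safe
        fix \<pi> assume p: "\<pi> permutes {2..n}"
        have inj: "inj_on \<pi> ?V" using perm(1)[OF p] by (rule permutes_inj_on)
        show "map_edges \<pi> E \<in> rooted_graphs A n"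
          using admissible_map_edges[OF adm inj] perm[OF p] by (simp add: rooted_graphs_def permutes_image)
        show "w \<in> loop_words E 1" if "w \<in> loop_words (map_edges \<pi> E) 1" for w
          using that loop_words_map_edges[OF G inj, of 1] perm[OF p] n by simp
        show "w \<in> loop_words (map_edges \<pi> E) 1" if "w \<in> loop_words E 1" for w
          using that loop_words_map_edges[OF G inj, of 1] perm[OF p] n by simp
      qed
      show "?R \<subseteq> ?L"
      proof safe
        fix E' assume E': "E' \<in> rooted_graphs A n" and eq: "loop_words E' 1 = loop_words E 1"
        from admissible_unique[OF adm, of ?V E' 1] E' eq obtain f
          where f: "bij_betw f ?V ?V" "f 1 = 1" "map_edges f E = E'" by (auto simp: rooted_graphs_def)
        define \<pi> where "\<pi> u = (if u \<in> ?V then f u else u)" for u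
        have "bij_betw \<pi> ?V ?V" using f(1) by (rule bij_betw_cong[THEN iffD1, rotated]) (simp add: \<pi>_def)
        then have "\<pi> permutes ?V" by (rule bij_imp_permutes) (auto simp: \<pi>_def)
        then have "\<pi> permutes {2..n}"
        proof (rule permutes_superset)
          fix u assume "u \<in> ?V - {2..n}"
          then have "u = 1" by auto
          then show "\<pi> u = u" using n f by (simp add: \<pi>_def)
        qed
        moreover have "map_edges \<pi> E = map_edges f E"
          unfolding map_edges_def using G by (intro image_cong) (auto simp: \<pi>_def A_graph_def)
        ultimately show "E' \<in> ?L" using f(3) by auto
      qed
    qed
  qed
  then have "card {E' \<in> rooted_graphs A n. loop_words E' 1 = loop_words E 1} = card {\<pi>. \<pi> permutes {2..n}}"
    by (simp add: bij_betw_same_card)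
  also have "\<dots> = fact (n - 1)" by (rule card_permutations) auto
  finally show ?thesis .
qed

lemma card_rooted_graphs:
  assumes "finite A" "n \<ge> 1"
  shows "card (rooted_graphs A n) = fact (n - 1) * num_subgroups A n"
proof -
  let ?g = "\<lambda>E. loop_words E 1"
  let ?R = "rooted_graphs A n"
  have "card ?R = (\<Sum>H\<in>?g ` ?R. card {E. E \<in> ?R \<and> ?g E = H})"
    using sum.image_gen[OF finite_rooted_graphs[OF assms(1)], of "\<lambda>_. 1::nat" n ?g] by simp
  also have "\<dots> = (\<Sum>H\<in>?g ` ?R. fact (n - 1))"
    by (intro sum.cong refl) (auto simp: card_labellings[OF assms(2)] simp del: One_nat_def)
  also have "\<dots> = fact (n - 1) * num_subgroups A n"
    by (simp add: num_subgroups_def subgroups_of_size[OF assms])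
  finally show ?thesis .
qed

section \<open>Counting partial injections\<close>

text \<open>Relations instead of partial functions, since the edges carrying a fixed label form a relation.\<close>

definition partial_injs :: "'v set \<Rightarrow> 'w set \<Rightarrow> ('v \<times> 'w) set set" where
  "partial_injs V W = {R. R \<subseteq> V \<times> W \<and> single_valued R \<and> single_valued (R\<inverse>)}"

definition inj_count :: "nat \<Rightarrow> nat \<Rightarrow> nat" where
  "inj_count m n = (\<Sum>j\<le>m. (m choose j) * (n choose j) * fact j)"

lemma card_injections:
  assumes "finite D" "finite W"
  shows "card {f \<in> D \<rightarrow>\<^sub>E W. inj_on f D} = (card W choose card D) * fact (card D)"
  using assms
proof (induction D arbitrary: W rule: finite_induct)
  case (insert x S)
  let ?G = "\<lambda>y. {g \<in> S \<rightarrow>\<^sub>E (W - {y}). inj_on g S}"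
  have "{(y, g). y \<in> W \<and> g \<in> S \<rightarrow>\<^sub>E (W - {y}) \<and> inj_on g S} = Sigma W ?G" by auto
  then have "{f \<in> insert x S \<rightarrow>\<^sub>E W. inj_on f (insert x S)} = (\<lambda>(y, g). g(x := y)) ` Sigma W ?G"
    using extensional_funcset_extend_domain_inj_on_eq[OF insert.hyps(2), of W] by simp
  moreover have "inj_on (\<lambda>(y, g). g(x := y)) (Sigma W ?G)"
  proof (rule inj_onI, clarsimp)
    fix y g y' g'
    assume "g \<in> S \<rightarrow>\<^sub>E W - {y}" "g' \<in> S \<rightarrow>\<^sub>E W - {y'}" and eq: "g(x := y) = g'(x := y')"
    then have "g x = undefined" "g' x = undefined" using insert.hyps(2) by (auto simp: PiE_def extensional_def)
    moreover have "y = y'" using fun_cong[OF eq, of x] by simp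
    moreover have "g z = g' z" if "z \<noteq> x" for z using fun_cong[OF eq, of z] that by simp
    ultimately show "y = y' \<and> g = g'" by (metis ext)
  qed
  ultimately have "card {f \<in> insert x S \<rightarrow>\<^sub>E W. inj_on f (insert x S)} = card (Sigma W ?G)"
    by (simp add: card_image)
  also have "\<dots> = (\<Sum>y\<in>W. card (?G y))"
    by (rule card_SigmaI) (use insert in \<open>auto simp: finite_PiE\<close>)
  also have "\<dots> = (\<Sum>y\<in>W. ((card W - 1) choose card S) * fact (card S))"
    using insert by (intro sum.cong refl) (subst insert.IH, auto simp: card_Diff_singleton)
  also have "\<dots> = (card W * ((card W - 1) choose card S)) * fact (card S)"
    by simp
  also have "card W * ((card W - 1) choose card S) = Suc (card S) * (card W choose Suc (card S))"
    by (rule binomial_absorption[symmetric])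
  finally show ?case using insert.hyps by (simp add: algebra_simps)
next
  case empty
  have "{f :: 'a \<Rightarrow> 'b. f = (\<lambda>x. undefined)} = {\<lambda>x. undefined}" by auto
  then show ?case by simp
qed

lemma card_partial_injs:
  assumes V: "finite V" and W: "finite W"
  shows "finite (partial_injs V W)" "card (partial_injs V W) = inj_count (card V) (card W)"
proof -
  show "finite (partial_injs V W)"
    by (rule finite_subset[of _ "Pow (V \<times> W)"]) (use V W in \<open>auto simp: partial_injs_def\<close>)
  let ?I = "\<lambda>D. {f \<in> D \<rightarrow>\<^sub>E W. inj_on f D}"
  let ?g = "\<lambda>(D, f). {(x, y). x \<in> D \<and> y = f x}"
  have "bij_betw ?g (Sigma (Pow V) ?I) (partial_injs V W)"
  proof (rule bij_betw_imageI)
    show "inj_on ?g (Sigma (Pow V) ?I)"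
    proof (rule inj_onI, clarsimp)
      fix D f D' f'
      assume f: "f \<in> D \<rightarrow>\<^sub>E W" "f' \<in> D' \<rightarrow>\<^sub>E W"
        and eq: "{(x, y). x \<in> D \<and> y = f x} = {(x, y). x \<in> D' \<and> y = f' x}"
      have *: "x \<in> D \<and> y = f x \<longleftrightarrow> x \<in> D' \<and> y = f' x" for x y
        using eq by (auto simp: set_eq_iff)
      then have D: "D = D'" by blast
      moreover have "f x = f' x" for x
        using * f D by (cases "x \<in> D") (auto simp: PiE_def extensional_def)
      ultimately show "D = D' \<and> f = f'" by blast
    qed
    show "?g ` Sigma (Pow V) ?I = partial_injs V W"
    proof
      show "?g ` Sigma (Pow V) ?I \<subseteq> partial_injs V W"
        by (auto simp: partial_injs_def single_valued_def inj_on_def PiE_def Pi_def)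
      show "partial_injs V W \<subseteq> ?g ` Sigma (Pow V) ?I"
      proof
        fix R assume R: "R \<in> partial_injs V W"
        then have sv: "single_valued R" "single_valued (R\<inverse>)" and sub: "R \<subseteq> V \<times> W"
          by (auto simp: partial_injs_def)
        define f where "f = (\<lambda>x\<in>Domain R. SOME y. (x, y) \<in> R)"
        have f: "(x, f x) \<in> R" if "x \<in> Domain R" for x
          using that by (auto simp: f_def intro: someI)
        have fR: "R = {(x, y). x \<in> Domain R \<and> y = f x}"
          using f sv(1) by (auto simp: single_valued_def)
        have "inj_on f (Domain R)"
          using f sv(2) by (intro inj_onI) (metis converseI single_valuedD)
        moreover have "f \<in> Domain R \<rightarrow>\<^sub>E W"
          using f sub by (auto simp: f_def)
        moreover have "Domain R \<subseteq> V" using sub by auto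
        ultimately have "(Domain R, f) \<in> Sigma (Pow V) ?I" by auto
        moreover have "R = ?g (Domain R, f)" using fR by simp
        ultimately show "R \<in> ?g ` Sigma (Pow V) ?I" by (rule rev_image_eqI)
      qed
    qed
  qed
  then have "card (partial_injs V W) = card (Sigma (Pow V) ?I)"
    by (simp add: bij_betw_same_card)
  also have "\<dots> = (\<Sum>D\<in>Pow V. card (?I D))"
    by (rule card_SigmaI) (use V W in \<open>auto intro!: finite_PiE intro: finite_subset\<close>)
  also have "\<dots> = (\<Sum>D\<in>Pow V. (card W choose card D) * fact (card D))"
    using V W by (intro sum.cong refl card_injections) (auto intro: finite_subset)
  also have "\<dots> = (\<Sum>j\<le>card V. \<Sum>D\<in>{D \<in> Pow V. card D = j}. (card W choose card D) * fact (card D))"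
    by (rule sum.group[symmetric]) (use V in \<open>auto intro: card_mono\<close>)
  also have "\<dots> = inj_count (card V) (card W)"
    unfolding inj_count_def
  proof (intro sum.cong refl)
    fix j
    show "(\<Sum>D\<in>{D \<in> Pow V. card D = j}. (card W choose card D) * fact (card D))
        = (card V choose j) * (card W choose j) * fact j"
      using n_subsets[OF V, of j] by simp
  qed
  finally show "card (partial_injs V W) = inj_count (card V) (card W)" .
qed

lemma num_partial_inj_eq: "num_partial_inj n = inj_count n n"
proof -
  let ?M = "{f :: nat \<rightharpoonup> nat. dom f \<subseteq> {1..n} \<and> ran f \<subseteq> {1..n} \<and> inj_on f (dom f)}"
  let ?g = "\<lambda>f :: nat \<rightharpoonup> nat. {(x, y). f x = Some y}"
  have "bij_betw ?g ?M (partial_injs {1..n} {1..n})"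
  proof (rule bij_betw_imageI)
    show "inj_on ?g ?M"
    proof (rule inj_onI)
      fix f f' :: "nat \<rightharpoonup> nat" assume "?g f = ?g f'"
      then have "f x = Some y \<longleftrightarrow> f' x = Some y" for x y by (auto simp: set_eq_iff)
      then have "f x = f' x" for x by (metis not_None_eq)
      then show "f = f'" by blast
    qed
    show "?g ` ?M = partial_injs {1..n} {1..n}"
    proof
      show "?g ` ?M \<subseteq> partial_injs {1..n} {1..n}"
      proof (rule image_subsetI)
        fix f assume "f \<in> ?M"
        then have f: "dom f \<subseteq> {1..n}" "ran f \<subseteq> {1..n}" "inj_on f (dom f)" by blast+
        have "x \<in> {1..n} \<and> y \<in> {1..n}" if "f x = Some y" for x y
          using f(1,2) domI[of f, OF that] ranI[of f, OF that] by blast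
        moreover have "x = x'" if "f x = Some y" "f x' = Some y" for x x' y
          using inj_onD[OF f(3), of x x'] that by (simp add: dom_def)
        ultimately show "?g f \<in> partial_injs {1..n} {1..n}"
          unfolding partial_injs_def single_valued_def by force
      qed
      show "partial_injs {1..n} {1..n} \<subseteq> ?g ` ?M"
      proof
        fix R assume R: "R \<in> partial_injs {1..n} {1..n}"
        then have sv: "single_valued R" "single_valued (R\<inverse>)" and sub: "R \<subseteq> {1..n} \<times> {1..n}"
          by (auto simp: partial_injs_def)
        define f where "f x = (if x \<in> Domain R then Some (SOME y. (x, y) \<in> R) else None)" for x
        have f: "f x = Some y \<longleftrightarrow> (x, y) \<in> R" for x y
          using sv(1) by (auto simp: f_def single_valued_def intro: someI split: if_splits)
        have "dom f \<subseteq> {1..n}" "ran f \<subseteq> {1..n}" using f sub by (auto simp: dom_def ran_def)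
        moreover have "inj_on f (dom f)"
          using f sv(2) by (intro inj_onI) (metis converseI single_valuedD domD)
        moreover have "R = ?g f" using f by auto
        ultimately show "R \<in> ?g ` ?M" by blast
      qed
    qed
  qed
  then have "num_partial_inj n = card (partial_injs {1..n} {1..n})"
    unfolding num_partial_inj_def by (rule bij_betw_same_card)
  then show ?thesis by (simp add: card_partial_injs)
qed

text \<open>The partial injections of an \<open>(m+1)\<close>-element set are split according to whether a fixed point
  \<open>w\<close> is missed by the image; if not, there are \<open>m + 1\<close> choices for the preimage of \<open>w\<close>. In this way
  the probability of missing \<open>w\<close> is expressed through \<open>inj_count m m\<close>. The proof is by Pascal's rule.\<close>

lemma inj_count_step: "inj_count (Suc m) m + Suc m * inj_count m m = inj_count (Suc m) (Suc m)"
proof -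
  have "inj_count (Suc m) (Suc m)
      = 1 + (\<Sum>j\<le>m. (Suc m choose Suc j) * (Suc m choose Suc j) * fact (Suc j))"
    unfolding inj_count_def by (subst sum.atMost_Suc_shift) simp
  also have "(\<Sum>j\<le>m. (Suc m choose Suc j) * (Suc m choose Suc j) * fact (Suc j))
      = (\<Sum>j\<le>m. (Suc m choose Suc j) * (m choose Suc j) * fact (Suc j) + Suc m * ((m choose j) * (m choose j) * fact j))"
  proof (intro sum.cong refl)
    fix j
    have "(Suc m choose Suc j) * (m choose j) * fact (Suc j) = (Suc j * (Suc m choose Suc j)) * (m choose j) * fact j"
      by (simp only: fact_Suc of_nat_id mult_ac)
    also have "Suc j * (Suc m choose Suc j) = Suc m * (m choose j)"
      using binomial_absorption[of j "Suc m"] by simp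
    finally have "(Suc m choose Suc j) * (m choose j) * fact (Suc j) = Suc m * ((m choose j) * (m choose j) * fact j)"
      by (simp only: mult_ac)
    moreover have "(Suc m choose Suc j) * (Suc m choose Suc j) * fact (Suc j)
       = (Suc m choose Suc j) * (m choose Suc j) * fact (Suc j) + (Suc m choose Suc j) * (m choose j) * fact (Suc j)"
      by (simp only: binomial_Suc_Suc[of m j] ring_distribs)
    ultimately show "(Suc m choose Suc j) * (Suc m choose Suc j) * fact (Suc j)
       = (Suc m choose Suc j) * (m choose Suc j) * fact (Suc j) + Suc m * ((m choose j) * (m choose j) * fact j)"
      by simp
  qed
  also have "1 + \<dots> = inj_count (Suc m) m + Suc m * inj_count m m"
    unfolding inj_count_def
    by (subst sum.atMost_Suc_shift[of _ m]) (simp only: sum.distrib sum_distrib_left binomial_n_0 fact_0 mult_1_right add.assoc)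
  finally show ?thesis by simp
qed

lemma inj_count_commute: "inj_count m n = inj_count n m"
proof -
  have "inj_count m n = (\<Sum>j\<le>max m n. (m choose j) * (n choose j) * fact j)" for m n
    unfolding inj_count_def by (intro sum.mono_neutral_left) auto
  from this[of m n] this[of n m] show ?thesis by (simp add: max.commute mult_ac)
qed

section \<open>Labelled graphs as families of partial injections\<close>

definition slice :: "('v \<times> 'a \<times> 'v) set \<Rightarrow> 'a \<Rightarrow> ('v \<times> 'v) set" where
  "slice E a = {(u, v). (u, a, v) \<in> E}"

lemma card_slices:
  assumes "finite A" and P: "\<And>a. a \<in> A \<Longrightarrow> P a \<subseteq> Pow (V \<times> V)"
  shows "card {E. E \<subseteq> V \<times> A \<times> V \<and> (\<forall>a\<in>A. slice E a \<in> P a)} = (\<Prod>a\<in>A. card (P a))"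
proof -
  have "bij_betw (\<lambda>E. \<lambda>a\<in>A. slice E a) {E. E \<subseteq> V \<times> A \<times> V \<and> (\<forall>a\<in>A. slice E a \<in> P a)} (PiE A P)"
  proof (rule bij_betw_byWitness[where f' = "\<lambda>F. {(u, a, v). a \<in> A \<and> (u, v) \<in> F a}"])
    show "\<forall>E\<in>{E. E \<subseteq> V \<times> A \<times> V \<and> (\<forall>a\<in>A. slice E a \<in> P a)}.
        {(u, a, v). a \<in> A \<and> (u, v) \<in> (\<lambda>a\<in>A. slice E a) a} = E"
      by (auto simp: slice_def)
    show "\<forall>F\<in>PiE A P. (\<lambda>a\<in>A. slice {(u, a, v). a \<in> A \<and> (u, v) \<in> F a} a) = F"
    proof
      fix F assume F: "F \<in> PiE A P"
      show "(\<lambda>a\<in>A. slice {(u, a, v). a \<in> A \<and> (u, v) \<in> F a} a) = F"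
      proof
        fix a show "(\<lambda>a\<in>A. slice {(u, a, v). a \<in> A \<and> (u, v) \<in> F a} a) a = F a"
          using F by (cases "a \<in> A") (auto simp: slice_def PiE_def extensional_def)
      qed
    qed
    show "(\<lambda>E. \<lambda>a\<in>A. slice E a) ` {E. E \<subseteq> V \<times> A \<times> V \<and> (\<forall>a\<in>A. slice E a \<in> P a)} \<subseteq> PiE A P"
      by auto
    show "(\<lambda>F. {(u, a, v). a \<in> A \<and> (u, v) \<in> F a}) ` PiE A P
        \<subseteq> {E. E \<subseteq> V \<times> A \<times> V \<and> (\<forall>a\<in>A. slice E a \<in> P a)}"
    proof (rule image_subsetI)
      fix F assume F: "F \<in> PiE A P"
      have "slice {(u, a, v). a \<in> A \<and> (u, v) \<in> F a} a = F a" if "a \<in> A" for a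
        using that by (auto simp: slice_def)
      moreover have "F a \<subseteq> V \<times> V" if "a \<in> A" for a using F P[OF that] that by (auto simp: PiE_def Pi_def)
      ultimately show "{(u, a, v). a \<in> A \<and> (u, v) \<in> F a} \<in> {E. E \<subseteq> V \<times> A \<times> V \<and> (\<forall>a\<in>A. slice E a \<in> P a)}"
        using F by (auto simp: PiE_def Pi_def)
    qed
  qed
  then have "card {E. E \<subseteq> V \<times> A \<times> V \<and> (\<forall>a\<in>A. slice E a \<in> P a)} = card (PiE A P)"
    by (rule bij_betw_same_card)
  also have "\<dots> = (\<Prod>a\<in>A. card (P a))" by (rule card_PiE[OF assms(1)])
  finally show ?thesis .
qed

lemma A_graph_slices:
  "A_graph A V E \<longleftrightarrow> finite V \<and> E \<subseteq> V \<times> A \<times> V \<and> (\<forall>a\<in>A. slice E a \<in> partial_injs V V)"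
proof
  assume "A_graph A V E"
  then show "finite V \<and> E \<subseteq> V \<times> A \<times> V \<and> (\<forall>a\<in>A. slice E a \<in> partial_injs V V)"
    unfolding A_graph_def slice_def partial_injs_def single_valued_def by simp blast
next
  assume G: "finite V \<and> E \<subseteq> V \<times> A \<times> V \<and> (\<forall>a\<in>A. slice E a \<in> partial_injs V V)"
  have "a \<in> A" if "(u, a, v) \<in> E" for u a v using G that by auto
  moreover have "v = v'" if "(u, a, v) \<in> E" "(u, a, v') \<in> E" "a \<in> A" for u a v v'
    using G that by (auto simp: slice_def partial_injs_def single_valued_def)
  moreover have "u = u'" if "(u, a, v) \<in> E" "(u', a, v) \<in> E" "a \<in> A" for u a v u'
    using G that by (auto simp: slice_def partial_injs_def single_valued_def)
  ultimately show "A_graph A V E" using G unfolding A_graph_def by blast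
qed

lemma partial_injs_Pow: "partial_injs V W \<subseteq> Pow (V \<times> W)"
  by (auto simp: partial_injs_def)

lemma card_A_graphs:
  assumes "finite A" "finite V"
  shows "card {E. A_graph A V E} = inj_count (card V) (card V) ^ card A"
  using card_slices[OF assms(1), of "\<lambda>_. partial_injs V V" V] assms
  by (simp add: A_graph_slices partial_injs_Pow card_partial_injs)

section \<open>Disconnected graphs\<close>

definition split_injs :: "'v set \<Rightarrow> 'v set \<Rightarrow> ('v \<times> 'v) set set" where
  "split_injs V S = {R \<in> partial_injs V V. R \<subseteq> S \<times> S \<union> (V - S) \<times> (V - S)}"

lemma partial_injs_subset: "R \<in> partial_injs V W \<Longrightarrow> R' \<subseteq> R \<Longrightarrow> R' \<subseteq> V' \<times> W' \<Longrightarrow> R' \<in> partial_injs V' W'"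
  unfolding partial_injs_def single_valued_def by blast

lemma card_split_injs:
  assumes V: "finite V" and S: "S \<subseteq> V"
  shows "card (split_injs V S) \<le> inj_count (card S) (card S) * inj_count (card V - card S) (card V - card S)"
proof -
  let ?T = "V - S"
  have fin: "finite S" "finite ?T" using V S finite_subset by auto
  have "card (split_injs V S) \<le> card (partial_injs S S \<times> partial_injs ?T ?T)"
  proof (rule card_inj_on_le[where f = "\<lambda>R. (R \<inter> S \<times> S, R \<inter> ?T \<times> ?T)"])
    show "inj_on (\<lambda>R. (R \<inter> S \<times> S, R \<inter> ?T \<times> ?T)) (split_injs V S)"
      unfolding inj_on_def split_injs_def by blast
    show "(\<lambda>R. (R \<inter> S \<times> S, R \<inter> ?T \<times> ?T)) ` split_injs V S \<subseteq> partial_injs S S \<times> partial_injs ?T ?T"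
      by (auto simp: split_injs_def intro: partial_injs_subset)
    show "finite (partial_injs S S \<times> partial_injs ?T ?T)" using fin by (simp add: card_partial_injs)
  qed
  also have "\<dots> = inj_count (card S) (card S) * inj_count (card V - card S) (card V - card S)"
    using fin V S by (simp add: card_cartesian_product card_partial_injs card_Diff_subset)
  finally show ?thesis .
qed

text \<open>Partial injections of two disjoint sets combine to one of their union.\<close>

lemma inj_count_product_le:
  assumes "k \<le> n"
  shows "inj_count k k * inj_count (n - k) (n - k) \<le> inj_count n n"
proof -
  let ?V = "{..<n}" and ?S = "{..<k}" and ?T = "{k..<n}"
  have "card (partial_injs ?S ?S \<times> partial_injs ?T ?T) \<le> card (partial_injs ?V ?V)"
  proof (rule card_inj_on_le[where f = "\<lambda>(R, Q). R \<union> Q"])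
    show "inj_on (\<lambda>(R, Q). R \<union> Q) (partial_injs ?S ?S \<times> partial_injs ?T ?T)"
    proof (rule inj_on_inverseI[where g = "\<lambda>P. (P \<inter> ?S \<times> ?S, P \<inter> ?T \<times> ?T)"], clarify)
      fix R Q assume "R \<in> partial_injs ?S ?S" "Q \<in> partial_injs ?T ?T"
      then have "R \<subseteq> ?S \<times> ?S" "Q \<subseteq> ?T \<times> ?T" by (auto simp: partial_injs_def)
      then show "(R \<union> Q) \<inter> ?S \<times> ?S = R \<and> (R \<union> Q) \<inter> ?T \<times> ?T = Q" by auto
    qed
    show "(\<lambda>(R, Q). R \<union> Q) ` (partial_injs ?S ?S \<times> partial_injs ?T ?T) \<subseteq> partial_injs ?V ?V"
    proof clarify
      fix R Q assume RQ: "R \<in> partial_injs ?S ?S" "Q \<in> partial_injs ?T ?T"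
      have R: "x < k \<and> y < k" if "(x, y) \<in> R" for x y using RQ(1) that by (auto simp: partial_injs_def)
      have Q: "k \<le> x \<and> k \<le> y \<and> x < n \<and> y < n" if "(x, y) \<in> Q" for x y
        using RQ(2) that by (auto simp: partial_injs_def)
      have sv: "single_valued R" "single_valued (R\<inverse>)" "single_valued Q" "single_valued (Q\<inverse>)"
        using RQ by (auto simp: partial_injs_def)
      have "single_valued (R \<union> Q)"
        by (rule single_valuedI) (metis R Q sv(1,3) Un_iff not_le single_valuedD)
      moreover have "single_valued ((R \<union> Q)\<inverse>)"
        by (rule single_valuedI) (metis R Q sv(2,4) Un_iff converse_iff not_le single_valuedD)
      moreover have "R \<union> Q \<subseteq> ?V \<times> ?V" using R Q assms by fastforce
      ultimately show "R \<union> Q \<in> partial_injs ?V ?V" by (simp add: partial_injs_def)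
    qed
  qed (simp add: card_partial_injs)
  then show ?thesis by (simp add: card_cartesian_product card_partial_injs)
qed

text \<open>Take the component of a vertex or its complement, whichever is smaller.\<close>

lemma disconnected_split:
  assumes G: "A_graph A V E" and "\<not> connected_graph V E"
  obtains S where "S \<subseteq> V" "S \<noteq> {}" "2 * card S \<le> card V" "\<And>a. a \<in> A \<Longrightarrow> slice E a \<in> split_injs V S"
proof -
  obtain u v where uv: "u \<in> V" "v \<in> V" "\<And>w. \<not> labels_path E u w v"
    using assms(2) unfolding connected_graph_iff by blast
  define C where "C = {x \<in> V. \<exists>w. labels_path E u w x}"
  have C: "C \<subseteq> V" "u \<in> C" "v \<notin> C"
    using uv by (auto simp: C_def intro: exI[of _ "[]"])
  have step: "y \<in> C" if x: "x \<in> C" and e: "edge E x l y" for x l y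
  proof -
    obtain w where "labels_path E u w x" using x by (auto simp: C_def)
    with e have "labels_path E u (w @ [l]) y" by (auto simp: labels_path_append labels_path_Cons)
    moreover have "y \<in> V" using edge_in[OF G e] by simp
    ultimately show ?thesis by (auto simp: C_def)
  qed
  have closed: "x \<in> C \<longleftrightarrow> y \<in> C" if "(x, a, y) \<in> E" for x a y
    using step[of x "(a, True)" y] step[of y "(a, False)" x] that by (auto simp: edge_def)
  have split: "slice E a \<in> split_injs V C" if "a \<in> A" for a
  proof -
    have R: "slice E a \<in> partial_injs V V" using G that unfolding A_graph_slices by blast
    moreover have "slice E a \<subseteq> C \<times> C \<union> (V - C) \<times> (V - C)"
    proof
      fix e assume e: "e \<in> slice E a"
      then obtain x y where xy: "e = (x, y)" "(x, a, y) \<in> E" by (auto simp: slice_def)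
      with R e have "x \<in> V" "y \<in> V" by (auto simp: partial_injs_def)
      with closed[OF xy(2)] xy(1) show "e \<in> C \<times> C \<union> (V - C) \<times> (V - C)" by auto
    qed
    ultimately show ?thesis by (simp add: split_injs_def)
  qed
  have fin: "finite V" using G by (simp add: A_graph_def)
  show thesis
  proof (cases "2 * card C \<le> card V")
    case True with that[of C] C split show ?thesis by blast
  next
    case False
    have "card (V - C) = card V - card C" using fin C by (simp add: card_Diff_subset finite_subset)
    moreover have "V - (V - C) = C" using C by auto
    ultimately show ?thesis
    proof (intro that[of "V - C"])
      show "V - C \<noteq> {}" using C uv by blast
      show "2 * card (V - C) \<le> card V" using \<open>card (V - C) = card V - card C\<close> False by linarith
      show "slice E a \<in> split_injs V (V - C)" if "a \<in> A" for a
        using split[OF that] C by (simp add: split_injs_def double_diff Un_commute)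
    qed blast
  qed
qed

lemma card_disconnected:
  assumes A: "finite A" and V: "finite V" and n: "card V = n"
  shows "card {E. A_graph A V E \<and> \<not> connected_graph V E}
     \<le> (\<Sum>k\<in>{1..n div 2}. (n choose k) * (inj_count k k * inj_count (n - k) (n - k)) ^ card A)"
proof -
  let ?D = "{S \<in> Pow V. card S \<in> {1..n div 2}}"
  let ?F = "\<lambda>S. {E. E \<subseteq> V \<times> A \<times> V \<and> (\<forall>a\<in>A. slice E a \<in> split_injs V S)}"
  let ?h = "\<lambda>k. (inj_count k k * inj_count (n - k) (n - k)) ^ card A"
  have finD: "finite ?D" using V by simp
  have "{E. A_graph A V E \<and> \<not> connected_graph V E} \<subseteq> (\<Union>S\<in>?D. ?F S)"
  proof
    fix E assume "E \<in> {E. A_graph A V E \<and> \<not> connected_graph V E}"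
    then have G: "A_graph A V E" "\<not> connected_graph V E" by auto
    from disconnected_split[OF G] obtain S where S: "S \<subseteq> V" "S \<noteq> {}" "2 * card S \<le> card V"
      "\<And>a. a \<in> A \<Longrightarrow> slice E a \<in> split_injs V S" by blast
    have "card S \<noteq> 0" using S V by (auto dest: finite_subset)
    then have "card S \<in> {1..n div 2}" using S(3) n by auto
    then have "S \<in> ?D" using S by auto
    moreover have "E \<in> ?F S" using S(4) G(1) by (simp add: A_graph_def)
    ultimately show "E \<in> (\<Union>S\<in>?D. ?F S)" by (rule UN_I)
  qed
  moreover have finF: "finite (?F S)" for S
    by (rule finite_subset[of _ "Pow (V \<times> A \<times> V)"]) (use A V in auto)
  ultimately have "card {E. A_graph A V E \<and> \<not> connected_graph V E} \<le> card (\<Union>S\<in>?D. ?F S)"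
    using finD by (intro card_mono) auto
  also have "\<dots> \<le> (\<Sum>S\<in>?D. card (?F S))" by (rule card_UN_le[OF finD])
  also have "\<dots> \<le> (\<Sum>S\<in>?D. ?h (card S))"
  proof (rule sum_mono)
    fix S assume "S \<in> ?D"
    then have "card (split_injs V S) \<le> inj_count (card S) (card S) * inj_count (n - card S) (n - card S)"
      using card_split_injs[OF V, of S] n by auto
    moreover have "card (?F S) = card (split_injs V S) ^ card A"
      by (subst card_slices[OF A]) (auto simp: split_injs_def partial_injs_def)
    ultimately show "card (?F S) \<le> ?h (card S)" by (simp add: power_mono)
  qed
  also have "\<dots> = (\<Sum>k\<in>{1..n div 2}. \<Sum>S\<in>{S \<in> ?D. card S = k}. ?h (card S))"
    by (rule sum.group[symmetric]) (use finD in auto)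
  also have "\<dots> = (\<Sum>k\<in>{1..n div 2}. (n choose k) * ?h k)"
  proof (intro sum.cong refl)
    fix k assume k: "k \<in> {1..n div 2}"
    then have "{S \<in> ?D. card S = k} = {S. S \<subseteq> V \<and> card S = k}" by auto
    then show "(\<Sum>S\<in>{S \<in> ?D. card S = k}. ?h (card S)) = (n choose k) * ?h k"
      using n_subsets[OF V, of k] n by simp
  qed
  finally show ?thesis .
qed

section \<open>Graphs with a leaf\<close>

text \<open>At a leaf \<open>w\<close> at most one edge end remains: all labels but one avoid \<open>w\<close> altogether, and the
  exceptional label \<open>a\<close> still avoids it on one side.\<close>

lemma leaf_slices:
  assumes A: "finite A" "A \<noteq> {}" and G: "A_graph A V E" and leaf: "leaf E w"
  obtains a where "a \<in> A" "slice E a \<in> partial_injs V (V - {w}) \<or> slice E a \<in> partial_injs (V - {w}) V"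
    "\<And>c. c \<in> A - {a} \<Longrightarrow> slice E c \<in> partial_injs (V - {w}) (V - {w})"
proof -
  let ?O = "{(u, a, v) \<in> E. u = w}" and ?I = "{(u, a, v) \<in> E. v = w}"
  have "finite E" by (rule A_graph_finite_edges[OF A(1) G])
  then have fin: "finite ?O" "finite ?I" by (auto intro: finite_subset)
  have sl: "slice E c \<in> partial_injs V V" if "c \<in> A" for c using G that unfolding A_graph_slices by blast
  have sub: "slice E c \<in> partial_injs V' W'"
    if "c \<in> A" "\<And>u v. (u, c, v) \<in> E \<Longrightarrow> u \<in> V \<Longrightarrow> v \<in> V \<Longrightarrow> u \<in> V' \<and> v \<in> W'" for c V' W'
    by (rule partial_injs_subset[OF sl[OF that(1)] order_refl])
       (use that sl[OF that(1)] in \<open>auto simp: slice_def partial_injs_def\<close>)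
  have inA: "a \<in> A" if "(u, a, v) \<in> E" for u a v using G that by (auto simp: A_graph_def)
  have le: "card ?O + card ?I \<le> 1" using leaf by (simp only: leaf_def)
  show thesis
  proof (cases "card ?O = 0")
    case False
    then have cO: "card ?O = 1" and cI: "card ?I = 0" using le by linarith+
    obtain e where e: "?O = {e}" using cO by (meson card_1_singletonE)
    have I: "?I = {}" using cI fin(2) by (meson card_0_eq)
    obtain a t where "e = (w, a, t)" "(w, a, t) \<in> E" using e by (cases e) blast
    then have O: "c = a \<and> s = t" if "(w, c, s) \<in> E" for c s using e that by blast
    have I': "(u, c, w) \<notin> E" for u c using I by blast
    show ?thesis
    proof (rule that[of a])
      show "a \<in> A" using inA \<open>(w, a, t) \<in> E\<close> by blast
      then show "slice E a \<in> partial_injs V (V - {w}) \<or> slice E a \<in> partial_injs (V - {w}) V"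
        using sub[of a V "V - {w}"] I' by blast
      show "slice E c \<in> partial_injs (V - {w}) (V - {w})" if "c \<in> A - {a}" for c
        using sub[of c "V - {w}" "V - {w}"] I' O that by blast
    qed
  next
    case True
    then have "?O = {}" using fin(1) by (meson card_0_eq)
    then have O': "(w, c, v) \<notin> E" for v c by blast
    have "card ?I \<le> 1" using le by linarith
    obtain a where a: "a \<in> A" "\<And>u c. (u, c, w) \<in> E \<Longrightarrow> c = a"
    proof (cases "card ?I = 0")
      case True
      then have "?I = {}" using fin(2) by (meson card_0_eq)
      with A(2) that show ?thesis by blast
    next
      case False
      then have "card ?I = 1" using \<open>card ?I \<le> 1\<close> by linarith
      then obtain e where e: "?I = {e}" by (meson card_1_singletonE)
      then obtain t a where "e = (t, a, w)" "(t, a, w) \<in> E" by (cases e) blast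
      then have "c = a" if "(u, c, w) \<in> E" for u c using e that by blast
      with that inA[OF \<open>(t, a, w) \<in> E\<close>] show ?thesis by blast
    qed
    show ?thesis
    proof (rule that[of a])
      show "a \<in> A" by (rule a(1))
      then show "slice E a \<in> partial_injs V (V - {w}) \<or> slice E a \<in> partial_injs (V - {w}) V"
        using sub[of a "V - {w}" V] O' by blast
      show "slice E c \<in> partial_injs (V - {w}) (V - {w})" if "c \<in> A - {a}" for c
        using sub[of c "V - {w}" "V - {w}"] O' a(2) that by blast
    qed
  qed
qed

lemma card_with_leaf:
  assumes A: "finite A" "A \<noteq> {}" and V: "finite V" and n: "card V = n"
  shows "card {E. A_graph A V E \<and> (\<exists>w\<in>V. leaf E w)}
     \<le> n * (card A * (2 * inj_count n (n - 1) * inj_count (n - 1) (n - 1) ^ (card A - 1)))"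
proof -
  let ?P = "\<lambda>w a c. if c = a then partial_injs V (V - {w}) \<union> partial_injs (V - {w}) V
     else partial_injs (V - {w}) (V - {w})"
  let ?F = "\<lambda>(w, a). {E. E \<subseteq> V \<times> A \<times> V \<and> (\<forall>c\<in>A. slice E c \<in> ?P w a c)}"
  let ?c = "2 * inj_count n (n - 1) * inj_count (n - 1) (n - 1) ^ (card A - 1)"
  have "{E. A_graph A V E \<and> (\<exists>w\<in>V. leaf E w)} \<subseteq> (\<Union>i\<in>V \<times> A. ?F i)"
  proof
    fix E assume "E \<in> {E. A_graph A V E \<and> (\<exists>w\<in>V. leaf E w)}"
    then obtain w where G: "A_graph A V E" and w: "w \<in> V" "leaf E w" by auto
    from leaf_slices[OF A G w(2)] obtain a where a: "a \<in> A"
      "slice E a \<in> partial_injs V (V - {w}) \<or> slice E a \<in> partial_injs (V - {w}) V"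
      "\<And>c. c \<in> A - {a} \<Longrightarrow> slice E c \<in> partial_injs (V - {w}) (V - {w})" by metis
    have "(w, a) \<in> V \<times> A" using w a by simp
    moreover have "E \<in> ?F (w, a)" using a G by (auto simp: A_graph_def)
    ultimately show "E \<in> (\<Union>i\<in>V \<times> A. ?F i)" by (rule UN_I)
  qed
  moreover have finF: "finite (?F i)" for i
    by (rule finite_subset[of _ "Pow (V \<times> A \<times> V)"]) (use A V in \<open>auto split: prod.splits\<close>)
  ultimately have "card {E. A_graph A V E \<and> (\<exists>w\<in>V. leaf E w)} \<le> card (\<Union>i\<in>V \<times> A. ?F i)"
    using A V by (intro card_mono) auto
  also have "\<dots> \<le> (\<Sum>i\<in>V \<times> A. card (?F i))" by (rule card_UN_le) (use A V in auto)
  also have "\<dots> \<le> (\<Sum>i\<in>V \<times> A. ?c)"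
  proof (rule sum_mono)
    fix i assume "i \<in> V \<times> A"
    then obtain w a where i: "i = (w, a)" and w: "w \<in> V" and a: "a \<in> A" by auto
    have cw: "card (V - {w}) = n - 1" using V w n by simp
    have "card (?F i) = (\<Prod>c\<in>A. card (?P w a c))"
      unfolding i prod.case by (rule card_slices[OF A(1)]) (auto simp: partial_injs_def split: if_splits)
    also have "\<dots> = card (partial_injs V (V - {w}) \<union> partial_injs (V - {w}) V) * (\<Prod>c\<in>A - {a}. card (partial_injs (V - {w}) (V - {w})))"
      by (subst prod.remove[OF A(1) a]) (auto intro!: arg_cong2[of _ _ _ _ "(*)"] prod.cong)
    also have "\<dots> \<le> ?c"
    proof (rule mult_le_mono)
      have "card (partial_injs V (V - {w}) \<union> partial_injs (V - {w}) V)
         \<le> card (partial_injs V (V - {w})) + card (partial_injs (V - {w}) V)" by (rule card_Un_le)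
      also have "\<dots> = 2 * inj_count n (n - 1)"
        using V cw n inj_count_commute[of n "n - 1"] by (simp add: card_partial_injs)
      finally show "card (partial_injs V (V - {w}) \<union> partial_injs (V - {w}) V) \<le> 2 * inj_count n (n - 1)" .
      show "(\<Prod>c\<in>A - {a}. card (partial_injs (V - {w}) (V - {w}))) \<le> inj_count (n - 1) (n - 1) ^ (card A - 1)"
        using V cw A a by (simp add: card_partial_injs)
    qed
    finally show "card (?F i) \<le> ?c" .
  qed
  also have "\<dots> = n * (card A * ?c)" using n by (simp add: card_cartesian_product)
  finally show ?thesis .
qed

lemma rooted_graphs_bounds:
  assumes A: "finite A" "A \<noteq> {}" and n: "n \<ge> 1"
  shows "card (rooted_graphs A n) \<le> inj_count n n ^ card A"
    "inj_count n n ^ card A \<le> card (rooted_graphs A n)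
      + (\<Sum>k\<in>{1..n div 2}. (n choose k) * (inj_count k k * inj_count (n - k) (n - k)) ^ card A)
      + n * (card A * (2 * inj_count n (n - 1) * inj_count (n - 1) (n - 1) ^ (card A - 1)))"
proof -
  let ?V = "{1..n}"
  have all: "card {E. A_graph A ?V E} = inj_count n n ^ card A"
    using card_A_graphs[OF A(1), of ?V] by simp
  have fin: "finite {E. A_graph A ?V E}" by (rule finite_A_graphs[OF A(1)]) simp
  show "card (rooted_graphs A n) \<le> inj_count n n ^ card A"
    unfolding all[symmetric] by (rule card_mono[OF fin]) (auto simp: rooted_graphs_def admissible_def)
  let ?D = "{E. A_graph A ?V E \<and> \<not> connected_graph ?V E}" and ?L = "{E. A_graph A ?V E \<and> (\<exists>w\<in>?V. leaf E w)}"
  have "{E. A_graph A ?V E} \<subseteq> rooted_graphs A n \<union> ?D \<union> ?L"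
    using n by (auto simp: rooted_graphs_def admissible_def trim_def)
  then have "card {E. A_graph A ?V E} \<le> card (rooted_graphs A n \<union> ?D \<union> ?L)"
    using fin finite_rooted_graphs[OF A(1)] by (intro card_mono) auto
  also have "\<dots> \<le> card (rooted_graphs A n) + card ?D + card ?L"
    by (meson card_Un_le add_le_mono1 order_trans)
  finally show "inj_count n n ^ card A \<le> card (rooted_graphs A n)
      + (\<Sum>k\<in>{1..n div 2}. (n choose k) * (inj_count k k * inj_count (n - k) (n - k)) ^ card A)
      + n * (card A * (2 * inj_count n (n - 1) * inj_count (n - 1) (n - 1) ^ (card A - 1)))"
    using card_disconnected[OF A(1), of ?V n] card_with_leaf[OF A, of ?V n] unfolding all by simp
qed

section \<open>The central binomial coefficient and Stirling's formula\<close>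

text \<open>The probability that a fair coin shows as many heads as tails in \<open>2 * j\<close> tosses.\<close>

definition central_prob :: "nat \<Rightarrow> real" where
  "central_prob j = real (2 * j choose j) / 4 ^ j"

lemma central_prob_0 [simp]: "central_prob 0 = 1"
  by (simp add: central_prob_def)

lemma central_prob_pos: "central_prob j > 0"
  by (simp add: central_prob_def)

lemma central_prob_fact: "central_prob j = fact (2 * j) / (fact j ^ 2 * 4 ^ j)"
proof -
  have "real (2 * j choose j) = fact (2 * j) / (fact j * fact (2 * j - j))"
    by (rule binomial_fact) simp
  then show ?thesis by (simp add: central_prob_def power2_eq_square)
qed

lemma central_prob_Suc: "central_prob (Suc j) = central_prob j * ((2 * j + 1) / (2 * j + 2))"
  by (simp add: central_prob_fact divide_simps power2_eq_square) (simp add: algebra_simps)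

lemma central_prob_antimono: "i \<le> j \<Longrightarrow> central_prob j \<le> central_prob i"
proof (rule lift_Suc_antimono_le[of central_prob])
  fix n show "central_prob (Suc n) \<le> central_prob n"
    unfolding central_prob_Suc using central_prob_pos[of n]
    by (intro mult_left_le) auto
qed

lemma wallis_central_prob:
  "(\<Prod>k=1..n. (4*real k^2) / (4*real k^2 - 1)) = 1 / ((2 * n + 1) * central_prob n ^ 2)"
proof (induction n)
  case (Suc n)
  define b where "b = central_prob n"
  have b: "b > 0" by (simp add: b_def central_prob_pos)
  have 1: "4 * (real (Suc n))^2 - 1 = (2 * n + 1) * (2 * n + 3)"
    by (simp add: power2_eq_square algebra_simps)
  have "(\<Prod>k=1..Suc n. (4*real k^2) / (4*real k^2 - 1))
      = 1 / ((2 * n + 1) * b ^ 2) * (4 * (real (Suc n))^2 / ((2 * n + 1) * (2 * n + 3)))"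
    unfolding 1[symmetric] using Suc by (simp add: b_def)
  also have "\<dots> = 1 / ((2 * n + 3) * (b * ((2 * n + 1) / (2 * n + 2))) ^ 2)"
  proof -
    have *: "1 / (u * b ^ 2) * (4 * w ^ 2 / (u * v)) = 1 / (v * (b * (u / (2 * w))) ^ 2)" for u v w :: real
      by (simp add: power_divide power_mult_distrib power2_eq_square mult_ac)
    have "real (2 * n + 2) = 2 * real (Suc n)" by simp
    then show ?thesis by (simp only: *[symmetric] of_nat_mult)
  qed
  also have "2 * n + 3 = 2 * Suc n + 1" by simp
  finally show ?case by (simp add: central_prob_Suc b_def add.commute)
qed simp

lemma central_prob_asymp: "(\<lambda>j. sqrt j * central_prob j) \<longlonglongrightarrow> 1 / sqrt pi"
proof -
  have "(\<lambda>n. sqrt ((real n / real (2 * n + 1)) / (\<Prod>k=1..n. (4*real k^2) / (4*real k^2 - 1))))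
          \<longlonglongrightarrow> sqrt ((1/2) / (pi / 2))"
  proof (intro tendsto_real_sqrt tendsto_divide[OF _ wallis])
    show "(\<lambda>n. real n / real (2 * n + 1)) \<longlonglongrightarrow> 1/2" by real_asymp
  qed simp
  also have "sqrt ((1/2) / (pi / 2)) = 1 / sqrt pi"
    by (simp add: real_sqrt_divide)
  also have "(\<lambda>n. sqrt ((real n / real (2 * n + 1)) / (\<Prod>k=1..n. (4*real k^2) / (4*real k^2 - 1))))
      = (\<lambda>n. sqrt n * central_prob n)"
  proof
    fix n
    have *: "x / c / (1 / (c * b ^ 2)) = x * b ^ 2" if "c > 0" for x b c :: real
      using that by (simp add: field_simps)
    have "real (2 * n + 1) = 2 * real n + 1" by simp
    then have eq: "real n / real (2 * n + 1) / (1 / ((2 * real n + 1) * central_prob n ^ 2))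
        = real n * central_prob n ^ 2"
      by (simp only:) (rule *, simp)
    show "sqrt (real n / real (2 * n + 1) / (\<Prod>k=1..n. (4*real k^2) / (4*real k^2 - 1)))
        = sqrt n * central_prob n"
      using central_prob_pos[of n] by (simp only: wallis_central_prob eq) (simp add: real_sqrt_mult)
  qed
  finally show ?thesis .
qed

text \<open>The logarithm of the quotient converges because its increments are \<open>O(1 / n^2)\<close>. The limit \<open>S\<close>
  is then found from the central binomial coefficient, which involves \<open>S / S^2\<close> and whose
  asymptotics are given by Wallis' product.\<close>

lemma stirling: "(\<lambda>n. fact n / (sqrt n * (n / exp 1) ^ n)) \<longlonglongrightarrow> sqrt (2 * pi)"
proof -
  define a :: "nat \<Rightarrow> real" where "a = (\<lambda>n. ln (fact n) - (n + 1/2) * ln n + n)"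
  have d: "a (Suc n) - a n = 1 - (n + 1/2) * (ln (Suc n) - ln n)" if "n > 0" for n
  proof -
    have "ln (fact (Suc n) :: real) = ln (Suc n) + ln (fact n)"
      by (simp add: ln_mult add_pos_nonneg del: of_nat_Suc)
    then show ?thesis by (simp add: a_def algebra_simps)
  qed
  have "summable (\<lambda>n. a (Suc n) - a n)"
  proof (rule summable_comparison_test_bigo)
    show "summable (\<lambda>n. norm (1 / real n ^ 2))"
      using inverse_power_summable[of 2, where ?'a = real] by (simp add: inverse_eq_divide)
    have "(\<lambda>n. 1 - (real n + 1/2) * (ln (real (Suc n)) - ln (real n))) \<in> O(\<lambda>n. 1 / real n ^ 2)"
      by real_asymp
    then show "(\<lambda>n. a (Suc n) - a n) \<in> O(\<lambda>n. 1 / real n ^ 2)"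
      by (rule landau_o.big.in_cong[THEN iffD1, rotated])
         (use d in \<open>auto intro!: eventually_mono[OF eventually_gt_at_top[of 0]]\<close>)
  qed
  then obtain s where "(\<lambda>n. a (Suc n) - a n) sums s" by (auto simp: summable_def)
  then have "(\<lambda>n. a n - a 0) \<longlonglongrightarrow> s"
    by (simp add: sums_def sum_lessThan_telescope)
  then have a: "a \<longlonglongrightarrow> s + a 0"
    using tendsto_add[of "\<lambda>n. a n - a 0" s sequentially "\<lambda>_. a 0" "a 0"] by simp
  define S where "S = exp (s + a 0)"
  define q :: "nat \<Rightarrow> real" where "q = (\<lambda>n. fact n / (sqrt n * (n / exp 1) ^ n))"
  have "q n = exp (a n)" if "n > 0" for n
  proof -
    have "ln (q n) = a n"
      using that by (simp add: q_def a_def ln_div ln_mult ln_realpow ln_sqrt algebra_simps)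
    moreover have "q n > 0" using that by (simp add: q_def)
    ultimately show ?thesis by (metis exp_ln)
  qed
  moreover have "(\<lambda>n. exp (a n)) \<longlonglongrightarrow> S" unfolding S_def by (intro tendsto_intros a)
  ultimately have q: "q \<longlonglongrightarrow> S"
    by (rule_tac Lim_transform_eventually)
       (auto intro!: eventually_mono[OF eventually_gt_at_top[of 0]])
  have S: "S > 0" by (simp add: S_def)
  have "(\<lambda>n. sqrt 2 * q (2 * n) / q n ^ 2) \<longlonglongrightarrow> sqrt 2 * S / S ^ 2"
    by (intro tendsto_intros q filterlim_compose[OF q]) (use S in \<open>auto intro: filterlim_subseq simp: strict_mono_def\<close>)
  moreover have "sqrt 2 * q (2 * n) / q n ^ 2 = sqrt n * central_prob n" if "n > 0" for n
    using that
    by (simp add: q_def central_prob_fact real_sqrt_mult power_mult_distrib power_divide power_mult divide_simps)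
       (simp add: power2_eq_square power_mult_distrib algebra_simps power_mult[symmetric] power_add[symmetric])
  ultimately have "(\<lambda>j. sqrt j * central_prob j) \<longlonglongrightarrow> sqrt 2 * S / S ^ 2"
    by (rule_tac Lim_transform_eventually)
       (auto intro!: eventually_mono[OF eventually_gt_at_top[of 0]])
  from LIMSEQ_unique[OF this central_prob_asymp] S have "S = sqrt (2 * pi)"
    by (simp add: power2_eq_square real_sqrt_mult field_simps)
  with q show ?thesis by (simp add: q_def)
qed

section \<open>Asymptotics of the number of partial injections\<close>

text \<open>The quotient of the falling factorial \<open>n * (n - 1) * ... * (n - j + 1)\<close> by \<open>n ^ j\<close>.\<close>

definition falling_ratio :: "nat \<Rightarrow> nat \<Rightarrow> real" where
  "falling_ratio n j = (\<Prod>i<j. 1 - real i / real n)"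

lemma falling_ratio_nonneg: "falling_ratio n j \<ge> 0"
proof (cases "j \<le> n")
  case True then show ?thesis unfolding falling_ratio_def by (intro prod_nonneg) (auto simp: divide_simps)
next
  case False
  then have "n \<in> {..<j}" by auto
  then show ?thesis
  proof (cases "n = 0")
    case False
    then have "falling_ratio n j = 0" unfolding falling_ratio_def
      using \<open>n \<in> {..<j}\<close> by (intro prod_zero) auto
    then show ?thesis by simp
  qed (simp add: falling_ratio_def)
qed

lemma falling_ratio_antimono: "i \<le> j \<Longrightarrow> falling_ratio n j \<le> falling_ratio n i"
proof (rule lift_Suc_antimono_le[of "falling_ratio n"])
  fix k show "falling_ratio n (Suc k) \<le> falling_ratio n k"
    using falling_ratio_nonneg[of n k]
    by (simp add: falling_ratio_def mult_left_le)
qed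

lemma falling_ratio_binomial:
  assumes "n > 0"
  shows "real (n choose j) * fact j = real n ^ j * falling_ratio n j"
proof -
  have "real (n choose j) * fact j = (\<Prod>i=0..<j. real n - real i)"
    by (simp add: binomial_gbinomial gbinomial_prod_rev)
  also have "\<dots> = (\<Prod>i<j. real n * (1 - real i / real n))"
    using assms by (intro prod.cong) (auto simp: field_simps)
  finally show ?thesis by (simp add: prod.distrib falling_ratio_def)
qed

text \<open>Since \<open>k n\<close> is about \<open>sqrt n\<close>, the logarithm is \<open>- (\<Sum>i<k n. i / n)\<close> up to an error of order
  \<open>k n ^ 3 / n ^ 2\<close>, and the sum tends to \<open>1/2\<close>. The factor \<open>exp (-1/2)\<close> in the asymptotics of
  partial injections comes from here.\<close>

lemma falling_ratio_asymp:
  assumes k: "(\<lambda>n. real (k n) / sqrt (real n)) \<longlonglongrightarrow> 1"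
  shows "(\<lambda>n. falling_ratio n (k n)) \<longlonglongrightarrow> exp (-1/2)"
proof -
  define t where "t = (\<lambda>n. real (k n) / sqrt (real n))"
  have t: "t \<longlonglongrightarrow> 1" using k by (simp add: t_def)
  have kt: "real (k n) = t n * sqrt n" if "n > 0" for n using that by (simp add: t_def)
  have sq: "(\<lambda>n. 1 / sqrt (real n)) \<longlonglongrightarrow> 0" by real_asymp
  have s1: "(\<Sum>i<k n. real i / real n) = t n ^ 2 / 2 - t n * (1 / sqrt n) / 2" if "n > 0" for n
  proof -
    have "(\<Sum>i<m. real i) = real m * (real m - 1) / 2" for m
      by (induction m) (auto simp: field_simps)
    then have "(\<Sum>i<k n. real i / real n) = real (k n) * (real (k n) - 1) / 2 / real n"
      by (simp only: sum_divide_distrib[symmetric])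
    also have "\<dots> = t n ^ 2 / 2 - t n * (1 / sqrt n) / 2"
      using that by (simp add: kt field_simps power2_eq_square)
    finally show ?thesis .
  qed
  have "(\<lambda>n. exp (- (t n ^ 2 / 2 - t n * (1 / sqrt n) / 2))) \<longlonglongrightarrow> exp (- (1^2/2 - 1 * 0 / 2))"
    by (intro tendsto_intros t sq) auto
  then have u: "(\<lambda>n. exp (- (t n ^ 2 / 2 - t n * (1 / sqrt n) / 2))) \<longlonglongrightarrow> exp (- 1/2)" by simp
  have "(\<lambda>n. exp (- (t n ^ 2 / 2 - t n * (1 / sqrt n) / 2) - 2 * t n ^ 3 * (1 / sqrt n)))
     \<longlonglongrightarrow> exp (- (1^2/2 - 1 * 0 / 2) - 2 * 1 ^ 3 * 0)"
    by (intro tendsto_intros t sq) auto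
  then have l: "(\<lambda>n. exp (- (t n ^ 2 / 2 - t n * (1 / sqrt n) / 2) - 2 * t n ^ 3 * (1 / sqrt n)))
     \<longlonglongrightarrow> exp (- 1/2)" by simp
  have "(\<lambda>n. t n * (1 / sqrt n)) \<longlonglongrightarrow> 1 * 0" by (intro tendsto_intros t sq)
  then have ev: "eventually (\<lambda>n. t n * (1 / sqrt n) < 1/2 \<and> n > 0) sequentially"
    by (intro eventually_conj order_tendstoD eventually_gt_at_top) auto
  have half: "real i / n \<le> 1/2" "i < n" if "t n * (1 / sqrt n) < 1/2 \<and> n > 0" "i < k n" for n i
  proof -
    have "real (k n) / n = t n * (sqrt n / n)" using that kt[of n] by simp
    also have "sqrt n / n = 1 / sqrt n" using that by (simp add: field_simps)
    finally have "real (k n) / n < 1/2" using that by simp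
    moreover have "real i / n \<le> real (k n) / n" using that by (simp add: divide_right_mono)
    ultimately show "real i / n \<le> 1/2" by linarith
    then show "i < n" using that by (simp add: field_simps)
  qed
  have eu: "eventually (\<lambda>n. falling_ratio n (k n) \<le> exp (- (t n ^ 2 / 2 - t n * (1 / sqrt n) / 2))) sequentially"
    using ev
  proof eventually_elim
    case (elim n)
    have "falling_ratio n (k n) \<le> (\<Prod>i<k n. exp (- (real i / n)))"
      unfolding falling_ratio_def
    proof (intro prod_mono conjI)
      fix i assume "i \<in> {..<k n}"
      with half[OF elim, of i] show "0 \<le> 1 - real i / n" by simp
      show "1 - real i / n \<le> exp (- (real i / n))" using exp_ge_add_one_self[of "- (real i / n)"] by simp
    qed
    also have "\<dots> = exp (- (\<Sum>i<k n. real i / n))" by (simp add: exp_sum sum_negf[symmetric])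
    finally show ?case using elim by (simp add: s1)
  qed
  have el: "eventually (\<lambda>n. exp (- (t n ^ 2 / 2 - t n * (1 / sqrt n) / 2) - 2 * t n ^ 3 * (1 / sqrt n))
       \<le> falling_ratio n (k n)) sequentially"
    using ev
  proof eventually_elim
    case (elim n)
    have "(\<Sum>i<k n. 2 * (real i / n)^2) \<le> (\<Sum>i<k n. 2 * (real (k n) / n)^2)"
      using elim by (intro sum_mono mult_left_mono power_mono divide_right_mono) auto
    also have "\<dots> = 2 * t n ^ 3 * (1 / sqrt n)"
    proof -
      have "sqrt (real n) ^ 4 = real n ^ 2"
        using real_sqrt_pow2[of "real n"] by (metis of_nat_0_le_iff power_mult numeral_times_numeral
          semiring_norm(12) semiring_norm(13))
      then show ?thesis using elim by (simp add: t_def field_simps power2_eq_square power3_eq_cube power4_eq_xxxx)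
    qed
    finally have s2: "(\<Sum>i<k n. 2 * (real i / n)^2) \<le> 2 * t n ^ 3 * (1 / sqrt n)" .
    have "exp (- (t n ^ 2 / 2 - t n * (1 / sqrt n) / 2) - 2 * t n ^ 3 * (1 / sqrt n))
       \<le> exp (- (\<Sum>i<k n. real i / n) - (\<Sum>i<k n. 2 * (real i / n)^2))"
      using s2 elim by (simp add: s1)
    also have "\<dots> = (\<Prod>i<k n. exp (- (real i / n) - 2 * (real i / n)^2))"
      by (simp add: exp_sum[symmetric] sum_subtractf sum_negf)
    also have "\<dots> \<le> falling_ratio n (k n)"
      unfolding falling_ratio_def
    proof (intro prod_mono conjI)
      fix i assume "i \<in> {..<k n}"
      with half[OF elim, of i] ln_one_minus_pos_lower_bound[of "real i / n"]
      have "- (real i / n) - 2 * (real i / n)^2 \<le> ln (1 - real i / n)" "1 - real i / n > 0" by auto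
      then show "exp (- (real i / n) - 2 * (real i / n)^2) \<le> 1 - real i / n"
        by (metis exp_le_cancel_iff exp_ln)
    qed simp
    finally show ?case .
  qed
  from tendsto_sandwich[OF el eu l u] show ?thesis .
qed

text \<open>The variance of a Poisson variable with mean \<open>y\<close> is \<open>y\<close>, stated without the normalising factor.\<close>

lemma poisson_variance:
  fixes y :: real
  shows "(\<lambda>k. y ^ k / fact k * (real k - y)^2) sums (y * exp y)"
proof -
  have s0: "(\<lambda>k. y ^ k / fact k) sums exp y"
    using exp_converges[of y] by (simp add: field_simps)
  have s1: "(\<lambda>k. real k * (y ^ k / fact k)) sums (y * exp y)"
  proof -
    have "(\<lambda>k. real (Suc k) * (y ^ Suc k / fact (Suc k))) sums (y * exp y)"
      using sums_mult[OF s0, of y] by (simp del: of_nat_Suc)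
    from sums_Suc[OF this] show ?thesis by simp
  qed
  have s2: "(\<lambda>k. real k * (real k - 1) * (y ^ k / fact k)) sums (y ^ 2 * exp y)"
  proof -
    have "(\<lambda>k. y * (real k * (y ^ k / fact k))) sums (y * (y * exp y))" by (rule sums_mult[OF s1])
    also have "(\<lambda>k. y * (real k * (y ^ k / fact k)))
       = (\<lambda>k. real (Suc k) * (real (Suc k) - 1) * (y ^ Suc k / fact (Suc k)))"
      by (simp add: fun_eq_iff divide_simps)
    finally have "(\<lambda>k. real (Suc k) * (real (Suc k) - 1) * (y ^ Suc k / fact (Suc k))) sums (y * (y * exp y))" .
    from sums_Suc[OF this] show ?thesis by (simp add: power2_eq_square mult_ac)
  qed
  have "(\<lambda>k. real k * (real k - 1) * (y ^ k / fact k) + (1 - 2 * y) * (real k * (y ^ k / fact k))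
       + y^2 * (y ^ k / fact k)) sums (y ^ 2 * exp y + (1 - 2 * y) * (y * exp y) + y^2 * exp y)"
    by (intro sums_add sums_mult s0 s1 s2)
  also have "y ^ 2 * exp y + (1 - 2 * y) * (y * exp y) + y^2 * exp y = y * exp y"
    by (simp add: power2_eq_square algebra_simps)
  also have "(\<lambda>k. real k * (real k - 1) * (y ^ k / fact k) + (1 - 2 * y) * (real k * (y ^ k / fact k))
       + y^2 * (y ^ k / fact k)) = (\<lambda>k. y ^ k / fact k * (real k - y)^2)"
  proof
    fix k
    have "k' * (k' - 1) * p + (1 - 2 * y) * (k' * p) + y^2 * p = p * (k' - y)^2" for k' p :: real
      by (simp add: power2_eq_square algebra_simps)
    then show "real k * (real k - 1) * (y ^ k / fact k) + (1 - 2 * y) * (real k * (y ^ k / fact k))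
       + y^2 * (y ^ k / fact k) = y ^ k / fact k * (real k - y)^2" .
  qed
  finally show ?thesis .
qed

text \<open>Chebyshev's inequality for the Poisson weights of mean \<open>y\<close> restricted to even arguments, whose
  total mass is \<open>cosh y\<close>: a bounded function \<open>F\<close> that lies between \<open>L\<close> and \<open>U\<close> near the mean has its
  weighted sum between \<open>L * cosh y\<close> and \<open>U * cosh y\<close> up to the tail. Both bounds hold
  termwise, with \<open>(k - y)^2 / D^2\<close> majorising the indicator of the tail.\<close>

lemma even_poisson_concentration:
  fixes y D M L U T :: real and F :: "nat \<Rightarrow> real"
  assumes y: "y > 0" "D > 0" and L: "0 \<le> L" and U: "0 \<le> U"
    and F: "\<And>j. 0 \<le> F j" "\<And>j. F j \<le> M"
    and win: "\<And>j. \<bar>2 * real j - y\<bar> \<le> D \<Longrightarrow> L \<le> F j \<and> F j \<le> U"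
    and T: "(\<lambda>j. y ^ (2 * j) / fact (2 * j) * F j) sums T"
  shows "T \<le> U * cosh y + M * (y * exp y / D^2)" "L * (cosh y - y * exp y / D^2) \<le> T"
proof -
  define p where "p = (\<lambda>k. y ^ k / fact k)"
  define e where "e = (\<lambda>k::nat. if even k then p k else 0)"
  have p: "p k \<ge> 0" for k using y by (simp add: p_def)
  have e: "e sums cosh y"
    using cosh_converges[of y] unfolding e_def p_def by (simp add: field_simps if_distrib cong: if_cong)
  have v: "(\<lambda>k. p k * ((real k - y)^2 / D^2)) sums (y * exp y / D^2)"
    using sums_divide[OF poisson_variance[of y], of "D^2"] by (simp add: p_def)
  have T': "(\<lambda>k. e k * F (k div 2)) sums T"
  proof (rule iffD1[OF sums_mono_reindex[of "\<lambda>j. 2 * j" "\<lambda>k. e k * F (k div 2)" T]])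
    show "e k * F (k div 2) = 0" if "k \<notin> range ((*) 2)" for k
      using that by (auto simp: e_def elim!: evenE)
  qed (use T in \<open>auto simp: strict_mono_def e_def p_def\<close>)
  have M: "M \<ge> 0" using F[of 0] by linarith
  have far: "1 \<le> (x - y)^2 / D^2" if "\<not> \<bar>x - y\<bar> \<le> D" for x
  proof -
    have "D^2 \<le> \<bar>x - y\<bar>^2" using that y by (intro power_mono) auto
    then show ?thesis using y by simp
  qed
  show "T \<le> U * cosh y + M * (y * exp y / D^2)"
  proof (rule sums_le[OF _ T' sums_add[OF sums_mult[OF e, of U] sums_mult[OF v, of M]]])
    fix k :: nat
    show "e k * F (k div 2) \<le> U * e k + M * (p k * ((real k - y)^2 / D^2))"
    proof (cases "even k")
      case True
      then have k: "2 * real (k div 2) = real k" by auto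
      have "F (k div 2) \<le> U + M * ((real k - y)^2 / D^2)"
      proof (cases "\<bar>real k - y\<bar> \<le> D")
        case True
        then have "F (k div 2) \<le> U" using win[of "k div 2"] k by simp
        moreover have "0 \<le> M * ((real k - y)^2 / D^2)" using M by simp
        ultimately show ?thesis by linarith
      next
        case False
        have "F (k div 2) \<le> M * 1" using F by simp
        also have "\<dots> \<le> M * ((real k - y)^2 / D^2)" by (intro mult_left_mono far False M)
        finally show ?thesis using U by simp
      qed
      from mult_left_mono[OF this p[of k]] True show ?thesis by (simp add: e_def algebra_simps)
    qed (use M p in \<open>simp add: e_def\<close>)
  qed
  show "L * (cosh y - y * exp y / D^2) \<le> T"
  proof (rule sums_le[OF _ sums_mult[OF sums_diff[OF e v], of L] T'])
    fix k :: nat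
    show "L * (e k - p k * ((real k - y)^2 / D^2)) \<le> e k * F (k div 2)"
    proof (cases "even k")
      case True
      then have k: "2 * real (k div 2) = real k" by auto
      have "L * (1 - (real k - y)^2 / D^2) \<le> F (k div 2)"
      proof (cases "\<bar>real k - y\<bar> \<le> D")
        case True
        then have "L \<le> F (k div 2)" using win[of "k div 2"] k by simp
        moreover have "L * (1 - (real k - y)^2 / D^2) \<le> L * 1" using L by (intro mult_left_mono) auto
        ultimately show ?thesis by simp
      next
        case False
        have "L * (1 - (real k - y)^2 / D^2) \<le> 0"
          using far[OF False] L by (intro mult_nonneg_nonpos) auto
        with F[of "k div 2"] show ?thesis by linarith
      qed
      from mult_left_mono[OF this p[of k]] True show ?thesis by (simp add: e_def algebra_simps)
    qed (use L p in \<open>simp add: e_def\<close>)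
  qed
qed

text \<open>The value at \<open>-1\<close> of the \<open>n\<close>-th Laguerre polynomial; multiplied by \<open>fact n\<close> it is the number of
  partial injections of an \<open>n\<close>-element set.\<close>

definition laguerre :: "nat \<Rightarrow> real" where
  "laguerre n = (\<Sum>j\<le>n. real (n choose j) / fact j)"

text \<open>With \<open>y = 2 * sqrt n\<close>, the \<open>j\<close>-th term of \<open>laguerre n\<close> equals
  \<open>y ^ (2 * j) / fact (2 * j) * (central_prob j * falling_ratio n j)\<close>. The first factor is a Poisson weight
  concentrated near \<open>2 * j = y\<close>, that is, near \<open>j = sqrt n\<close>. There the second factor \<open>F n j\<close> is about
  \<open>1 / sqrt (pi * sqrt n) * exp (-1/2)\<close>, while the weights add up to \<open>cosh y\<close>, about \<open>exp y / 2\<close>. As \<open>F n\<close>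
  is decreasing, its values on a window are controlled by those at the endpoints.\<close>

lemma laguerre_asymp:
  "(\<lambda>n. laguerre n * n powr (1/4) / exp (2 * sqrt n)) \<longlonglongrightarrow> exp (-1/2) / (2 * sqrt pi)"
proof -
  define F where "F = (\<lambda>n j. central_prob j * falling_ratio n j)"
  \<comment> \<open>The exponent \<open>7/16\<close> lies between \<open>3/8\<close>, above which Chebyshev's tail bound is
    negligible against \<open>n powr (-1/4)\<close>, and \<open>1/2\<close>, below which the window is narrow compared to \<open>sqrt n\<close>.\<close>
  define lo where "lo = (\<lambda>n. nat \<lceil>sqrt (real n) - n powr (7/16)\<rceil>)"
  define hi where "hi = (\<lambda>n. nat \<lfloor>sqrt (real n) + n powr (7/16)\<rfloor>)"
  have F0: "F n j \<ge> 0" for n j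
    using central_prob_pos[of j] falling_ratio_nonneg[of n j] by (simp add: F_def)
  have Fmono: "F n j \<le> F n i" if "i \<le> j" for n i j
    unfolding F_def using central_prob_pos falling_ratio_nonneg central_prob_antimono[OF that] falling_ratio_antimono[OF that]
    by (intro mult_mono) (auto intro: less_imp_le)
  have F1: "F n j \<le> 1" for n j
    using Fmono[of 0 j n] by (simp add: F_def falling_ratio_def)
  have sums: "(\<lambda>j. (2 * sqrt n) ^ (2 * j) / fact (2 * j) * F n j) sums laguerre n" if "n > 0" for n :: nat
  proof -
    have "(2 * sqrt n) ^ (2 * j) / fact (2 * j) * F n j = real (n choose j) / fact j" for j
    proof -
      have "(2 * sqrt n) ^ (2 * j) = 4 ^ j * real n ^ j"
        by (simp add: power_mult power_mult_distrib)
      then have "(2 * sqrt n) ^ (2 * j) / fact (2 * j) * F n j = real n ^ j * falling_ratio n j / fact j ^ 2"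
        by (simp add: F_def central_prob_fact)
      also have "real n ^ j * falling_ratio n j = real (n choose j) * fact j"
        using falling_ratio_binomial[OF that] by simp
      finally show ?thesis by (simp add: power2_eq_square)
    qed
    moreover have "(\<lambda>j. real (n choose j) / fact j) sums (\<Sum>j\<le>n. real (n choose j) / fact j)"
      by (intro sums_finite) auto
    ultimately show ?thesis by (simp add: laguerre_def)
  qed
  define y where "y = (\<lambda>n::nat. 2 * sqrt (real n))"
  define D where "D = (\<lambda>n::nat. 2 * real n powr (7/16))"
  have bd: "laguerre n \<le> F n (lo n) * cosh (y n) + 1 * (y n * exp (y n) / D n ^2)"
    "F n (hi n) * (cosh (y n) - y n * exp (y n) / D n ^2) \<le> laguerre n" if "n > 0" for n
  proof -
    have win: "F n (hi n) \<le> F n j \<and> F n j \<le> F n (lo n)" if "\<bar>2 * real j - y n\<bar> \<le> D n" for j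
    proof -
      have "sqrt n - n powr (7/16) \<le> real j" "real j \<le> sqrt n + n powr (7/16)"
        using that by (auto simp: y_def D_def)
      then have "lo n \<le> j" "j \<le> hi n" unfolding lo_def hi_def by (auto simp: nat_le_iff ceiling_le_iff le_nat_iff le_floor_iff)
      then show ?thesis by (simp add: Fmono)
    qed
    note c = even_poisson_concentration[of "y n" "D n" "F n (hi n)" "F n (lo n)" "F n" 1 "laguerre n", OF _ _ F0 F0 F0 F1 win]
    have "y n > 0" "D n > 0" using that by (auto simp: y_def D_def)
    then show "laguerre n \<le> F n (lo n) * cosh (y n) + 1 * (y n * exp (y n) / D n ^2)"
    "F n (hi n) * (cosh (y n) - y n * exp (y n) / D n ^2) \<le> laguerre n"
      using c sums[OF that] by (auto simp: y_def)
  qed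
  have lim: "(\<lambda>n. n powr (1/4) * F n (k n)) \<longlonglongrightarrow> exp (-1/2) / sqrt pi"
    if k: "(\<lambda>n. real (k n) / sqrt (real n)) \<longlonglongrightarrow> 1" for k
  proof -
    have "filterlim (\<lambda>n. real (k n) / sqrt n * sqrt n) at_top sequentially"
      by (rule filterlim_tendsto_pos_mult_at_top[OF k]) (simp, real_asymp)
    moreover have "eventually (\<lambda>n. real (k n) / sqrt n * sqrt n = real (k n)) sequentially"
      by (intro eventually_mono[OF eventually_gt_at_top[of 0]]) auto
    ultimately have "filterlim (\<lambda>n. real (k n)) at_top sequentially"
      by (simp only: filterlim_cong[OF refl refl])
    then have kt: "filterlim k at_top sequentially"
      by (simp add: filterlim_sequentially_iff_filterlim_real)
    have "(\<lambda>n. 1 / sqrt (real (k n) / sqrt n) * (sqrt (k n) * central_prob (k n)) * falling_ratio n (k n))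
       \<longlonglongrightarrow> 1 / sqrt 1 * (1 / sqrt pi) * exp (-1/2)"
      by (intro tendsto_intros k filterlim_compose[OF central_prob_asymp kt] falling_ratio_asymp) auto
    moreover have "eventually (\<lambda>n. 1 / sqrt (real (k n) / sqrt n) * (sqrt (k n) * central_prob (k n)) * falling_ratio n (k n)
        = n powr (1/4) * F n (k n)) sequentially"
      using filterlim_at_top[THEN iffD1, OF kt, rule_format, of 1] eventually_gt_at_top[of 0]
    proof eventually_elim
      case (elim n)
      have "sqrt (sqrt (real n)) = n powr (1/4)"
        by (simp add: powr_half_sqrt[symmetric] powr_powr)
      with elim show ?case by (simp add: F_def real_sqrt_divide)
    qed
    ultimately show ?thesis by (simp add: Lim_transform_eventually)
  qed
  have lo: "(\<lambda>n. real (lo n) / sqrt (real n)) \<longlonglongrightarrow> 1"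
  proof -
    have "(\<lambda>n::nat. real_of_int \<lceil>sqrt (real n) - n powr (7/16)\<rceil> / sqrt n) \<longlonglongrightarrow> 1" by real_asymp
    moreover have "eventually (\<lambda>n::nat. sqrt (real n) - n powr (7/16) > 0) sequentially" by real_asymp
    then have "eventually (\<lambda>n. real_of_int \<lceil>sqrt (real n) - n powr (7/16)\<rceil> / sqrt n = real (lo n) / sqrt (real n)) sequentially"
      by eventually_elim (auto simp: lo_def)
    ultimately show ?thesis by (rule Lim_transform_eventually)
  qed
  have hi: "(\<lambda>n. real (hi n) / sqrt (real n)) \<longlonglongrightarrow> 1"
  proof -
    have "(\<lambda>n::nat. real_of_int \<lfloor>sqrt (real n) + n powr (7/16)\<rfloor> / sqrt n) \<longlonglongrightarrow> 1" by real_asymp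
    then show ?thesis by (simp add: hi_def)
  qed
  define C where "C = (\<lambda>n::nat. cosh (2 * sqrt n) / exp (2 * sqrt n))"
  define R where "R = (\<lambda>n::nat. 2 * sqrt n / (4 * real n powr (7/8)))"
  have C: "C \<longlonglongrightarrow> 1/2" unfolding C_def cosh_def scaleR_conv_of_real of_real_inverse of_real_numeral by real_asymp
  have R: "R \<longlonglongrightarrow> 0" "(\<lambda>n. n powr (1/4) * R n) \<longlonglongrightarrow> 0" unfolding R_def by real_asymp+
  have yD: "y n * exp (y n) / D n ^2 = R n * exp (2 * sqrt n)" if "n > 0" for n
    using that by (simp add: y_def D_def R_def power2_eq_square powr_add[symmetric])
  show ?thesis
  proof -
    have "(\<lambda>n. (n powr (1/4) * F n (lo n)) * C n + n powr (1/4) * R n) \<longlonglongrightarrow> (exp (-1/2) / sqrt pi) * (1/2) + 0"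
      by (intro tendsto_intros lim lo C R)
    then have u: "(\<lambda>n. (n powr (1/4) * F n (lo n)) * C n + n powr (1/4) * R n) \<longlonglongrightarrow> exp (-1/2) / (2 * sqrt pi)" by (simp add: mult.commute)
    have "(\<lambda>n. (n powr (1/4) * F n (hi n)) * (C n - R n)) \<longlonglongrightarrow> (exp (-1/2) / sqrt pi) * (1/2 - 0)"
      by (intro tendsto_intros lim hi C R)
    then have l: "(\<lambda>n. (n powr (1/4) * F n (hi n)) * (C n - R n)) \<longlonglongrightarrow> exp (-1/2) / (2 * sqrt pi)" by (simp add: mult.commute)
    have eu: "eventually (\<lambda>n. laguerre n * n powr (1/4) / exp (2 * sqrt n)
        \<le> (n powr (1/4) * F n (lo n)) * C n + n powr (1/4) * R n) sequentially"
      using eventually_gt_at_top[of 0]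
    proof eventually_elim
      case (elim n)
      have "laguerre n * (n powr (1/4) / exp (2 * sqrt n)) \<le>
         (F n (lo n) * cosh (y n) + 1 * (y n * exp (y n) / D n ^2)) * (n powr (1/4) / exp (2 * sqrt n))"
        by (intro mult_right_mono bd elim) auto
      also have "\<dots> = (n powr (1/4) * F n (lo n)) * C n + n powr (1/4) * R n"
        unfolding yD[OF elim] by (simp add: C_def y_def field_simps)
      finally show ?case by simp
    qed
    have el: "eventually (\<lambda>n. (n powr (1/4) * F n (hi n)) * (C n - R n) \<le> laguerre n * n powr (1/4) / exp (2 * sqrt n)) sequentially"
      using eventually_gt_at_top[of 0]
    proof eventually_elim
      case (elim n)
      have "(n powr (1/4) * F n (hi n)) * (C n - R n) =
         (F n (hi n) * (cosh (y n) - y n * exp (y n) / D n ^2)) * (n powr (1/4) / exp (2 * sqrt n))"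
        unfolding yD[OF elim] by (simp add: C_def y_def field_simps)
      also have "\<dots> \<le> laguerre n * (n powr (1/4) / exp (2 * sqrt n))"
        by (intro mult_right_mono bd elim) auto
      finally show ?case by simp
    qed
    from tendsto_sandwich[OF el eu l u] show ?thesis .
  qed
qed

section \<open>Almost all graphs are admissible\<close>

lemma inj_count_laguerre: "real (inj_count n n) = fact n * laguerre n"
proof -
  have "real ((n choose j) * (n choose j) * fact j) = fact n * (real (n choose (n - j)) / fact (n - j))"
    if "j \<le> n" for j
  proof -
    have "real (n choose j) * fact j = fact n / fact (n - j)"
      using that by (simp add: binomial_fact)
    then have "real (n choose j) * (real (n choose j) * fact j) = real (n choose j) * (fact n / fact (n - j))"
      by simp
    then show ?thesis using binomial_symmetric[OF that] by (simp add: mult_ac)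
  qed
  then have "real (inj_count n n) = (\<Sum>j\<le>n. fact n * (real (n choose (n - j)) / fact (n - j)))"
    unfolding inj_count_def of_nat_sum by (intro sum.cong) auto
  also have "\<dots> = (\<Sum>j\<le>n. fact n * (real (n choose j) / fact j))"
    by (rule sum.reindex_bij_witness[where i = "\<lambda>j. n - j" and j = "\<lambda>j. n - j"]) auto
  finally show ?thesis by (simp add: laguerre_def sum_distrib_left)
qed

lemma laguerre_ge_1: "laguerre n \<ge> 1"
proof -
  have "(\<Sum>j\<in>{0}. real (n choose j) / fact j) \<le> laguerre n"
    unfolding laguerre_def by (rule sum_mono2) auto
  then show ?thesis by simp
qed

lemma laguerre_mono: "m \<le> n \<Longrightarrow> laguerre m \<le> laguerre n"
proof -
  assume mn: "m \<le> n"
  have "laguerre m \<le> (\<Sum>j\<le>m. real (n choose j) / fact j)"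
    unfolding laguerre_def using mn by (intro sum_mono divide_right_mono) (auto intro: binomial_right_mono)
  also have "\<dots> \<le> laguerre n" unfolding laguerre_def using mn by (intro sum_mono2) auto
  finally show ?thesis .
qed

text \<open>The terms are at most \<open>(sqrt n ^ j / fact j)^2\<close>, and a sum of squares of nonnegative numbers is
  bounded by the square of their sum.\<close>

lemma laguerre_le_exp: "laguerre n \<le> exp (2 * sqrt n)"
proof -
  have nn: "0 \<le> sqrt n ^ j / fact j" for j by simp
  have "laguerre n \<le> (\<Sum>j\<le>n. (sqrt n ^ j / fact j) ^ 2)"
    unfolding laguerre_def
  proof (rule sum_mono)
    fix j
    have "(n choose j) * fact j \<le> n ^ j" by (rule binomial_fact_pow)
    then have "real (n choose j) * fact j \<le> real n ^ j"
      by (metis of_nat_fact of_nat_le_iff of_nat_mult of_nat_power)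
    moreover have "(sqrt n ^ j) ^ 2 = real n ^ j"
      by (metis of_nat_0_le_iff power_commutes power_mult real_sqrt_pow2 mult.commute)
    ultimately show "real (n choose j) / fact j \<le> (sqrt n ^ j / fact j) ^ 2"
      by (simp add: power_divide field_simps power2_eq_square)
  qed
  also have "\<dots> \<le> (\<Sum>j\<le>n. sqrt n ^ j / fact j) ^ 2"
  proof -
    have "(\<Sum>j\<le>n. (sqrt n ^ j / fact j) ^ 2) \<le> (\<Sum>j\<le>n. (sqrt n ^ j / fact j) * (\<Sum>i\<le>n. sqrt n ^ i / fact i))"
    proof (rule sum_mono)
      fix j assume "j \<in> {..n}"
      then have "sqrt n ^ j / fact j \<le> (\<Sum>i\<le>n. sqrt n ^ i / fact i)"
        using nn by (intro member_le_sum) auto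
      then show "(sqrt n ^ j / fact j) ^ 2 \<le> (sqrt n ^ j / fact j) * (\<Sum>i\<le>n. sqrt n ^ i / fact i)"
        unfolding power2_eq_square using nn by (rule mult_left_mono)
    qed
    then show ?thesis by (simp only: power2_eq_square sum_distrib_right[symmetric])
  qed
  also have "\<dots> \<le> exp (sqrt n) ^ 2"
  proof (rule power_mono)
    have "(\<lambda>j. sqrt n ^ j / fact j) sums exp (sqrt n)"
      using exp_converges[of "sqrt (real n)"] by (simp add: field_simps)
    then show "(\<Sum>j\<le>n. sqrt n ^ j / fact j) \<le> exp (sqrt n)"
      using sum_le_suminf[of "\<lambda>j. sqrt n ^ j / fact j" "{..n}"] nn by (auto simp: sums_iff)
  qed (use nn in \<open>auto intro: sum_nonneg\<close>)
  also have "\<dots> = exp (2 * sqrt n)" by (simp add: exp_double)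
  finally show ?thesis .
qed

lemma laguerre_ratio: "(\<lambda>n. laguerre (n - 1) / laguerre n) \<longlonglongrightarrow> 1"
proof -
  define K :: real where "K = exp (-1/2) / (2 * sqrt pi)"
  define q where "q = (\<lambda>n. laguerre n * n powr (1/4) / exp (2 * sqrt n))"
  have q: "q \<longlonglongrightarrow> K" using laguerre_asymp by (simp add: q_def K_def)
  have K: "K \<noteq> 0" by (simp add: K_def)
  have "(\<lambda>n. q n / q (Suc n) * (exp (2 * sqrt n) / exp (2 * sqrt (Suc n)) * (Suc n powr (1/4) / n powr (1/4)))) \<longlonglongrightarrow> K / K * 1"
  proof (intro tendsto_mult tendsto_divide[OF q LIMSEQ_Suc[OF q] K])
    show "(\<lambda>n::nat. exp (2 * sqrt n) / exp (2 * sqrt (Suc n)) * (Suc n powr (1/4) / n powr (1/4))) \<longlonglongrightarrow> 1"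
      by real_asymp
  qed
  moreover have "eventually (\<lambda>n. q n / q (Suc n) * (exp (2 * sqrt n) / exp (2 * sqrt (Suc n)) * (Suc n powr (1/4) / n powr (1/4)))
     = laguerre n / laguerre (Suc n)) sequentially"
    using eventually_gt_at_top[of 0] by eventually_elim (simp add: q_def divide_simps)
  ultimately have "(\<lambda>n. laguerre n / laguerre (Suc n)) \<longlonglongrightarrow> 1"
    using K by (simp add: Lim_transform_eventually)
  then have "(\<lambda>n. laguerre (Suc n - 1) / laguerre (Suc n)) \<longlonglongrightarrow> 1" by simp
  then show ?thesis by (rule LIMSEQ_imp_Suc)
qed

text \<open>The left-hand side is \<open>B * (x / B) ^ r\<close>, where \<open>B\<close> is the binomial coefficient and \<open>x\<close> is a quotient of
  \<open>laguerre\<close> values that is at most \<open>exp (2 * sqrt k)\<close>. As \<open>x / B \<le> 1\<close> and \<open>r \<ge> 2\<close>, it is at most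
  \<open>x^2 / B\<close>. One factor \<open>sqrt B \<ge> sqrt n\<close> gives decay in \<open>n\<close>, the other one,
  \<open>sqrt B \<ge> sqrt 2 ^ k\<close>, makes the bound summable over \<open>k\<close>.\<close>

lemma disconnected_bound:
  assumes r: "r \<ge> 2" and n: "n \<ge> 1" and k: "k \<in> {1..n div 2}"
  shows "real (n choose k) * real (inj_count k k * inj_count (n - k) (n - k)) ^ r / real (inj_count n n) ^ r
    \<le> exp (4 * sqrt k) * sqrt (1/2) ^ k / sqrt n"
proof -
  have kn: "1 \<le> k" "k \<le> n" "2 * k \<le> n" using k by auto
  define x where "x = laguerre k * laguerre (n - k) / laguerre n"
  define B where "B = real (n choose k)"
  have B1: "B \<ge> 1" using kn zero_less_binomial[of k n] unfolding B_def by linarith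
  have lp: "laguerre m > 0" for m using laguerre_ge_1[of m] by linarith
  have x0: "x \<ge> 0" using lp by (simp add: x_def less_imp_le)
  have eq: "real (inj_count k k * inj_count (n - k) (n - k)) / real (inj_count n n) = x / B"
    unfolding of_nat_mult inj_count_laguerre x_def B_def binomial_fact[OF kn(2)] by (simp add: mult_ac)
  have le: "x \<le> exp (2 * sqrt k)"
  proof -
    have "laguerre (n - k) \<le> laguerre n" by (rule laguerre_mono) simp
    then have "laguerre (n - k) / laguerre n \<le> 1" using lp by simp
    then have "x \<le> laguerre k * 1" unfolding x_def times_divide_eq_right[symmetric]
      using lp[of k] by (intro mult_left_mono) auto
    with laguerre_le_exp[of k] show ?thesis by simp
  qed
  have x1: "x / B \<le> 1"
  proof -
    have "inj_count k k * inj_count (n - k) (n - k) \<le> inj_count n n"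
      using inj_count_product_le[OF kn(2)] .
    moreover have "inj_count n n > 0" using inj_count_laguerre[of n] lp[of n] by (metis fact_gt_zero mult_pos_pos of_nat_0_less_iff)
    ultimately have "real (inj_count k k * inj_count (n - k) (n - k)) / real (inj_count n n) \<le> 1"
      by (simp add: divide_le_eq_1 del: of_nat_mult)
    then show ?thesis by (simp only: eq)
  qed
  have "B * real (inj_count k k * inj_count (n - k) (n - k)) ^ r / real (inj_count n n) ^ r = B * (x / B) ^ r"
    by (simp only: eq[symmetric] power_divide times_divide_eq_right)
  also have "\<dots> \<le> B * (x / B) ^ 2"
    using r x0 x1 B1 by (intro mult_left_mono power_decreasing) auto
  also have "\<dots> = x ^ 2 / B" using B1 by (simp add: power2_eq_square)
  also have "\<dots> \<le> exp (4 * sqrt k) * (sqrt (1/2) ^ k / sqrt n)"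
  proof -
    have "x ^ 2 \<le> exp (2 * sqrt k) ^ 2" using le x0 by (rule power_mono)
    also have "\<dots> = exp (4 * sqrt k)" by (simp flip: exp_of_nat_mult)
    finally have 1: "x ^ 2 \<le> exp (4 * sqrt k)" .
    have "n \<le> n choose k"
    proof -
      have "n choose 1 \<le> n choose k" by (rule binomial_mono) (use kn in auto)
      then show ?thesis by simp
    qed
    then have "sqrt n \<le> sqrt B" unfolding B_def by simp
    moreover have "sqrt 2 ^ k \<le> sqrt B"
    proof -
      have "real n / real k \<ge> 2" using kn by (simp add: field_simps)
      then have "2 ^ k \<le> (real n / real k) ^ k" by (intro power_mono) auto
      also have "\<dots> \<le> B" unfolding B_def using kn(2) by (rule binomial_ge_n_over_k_pow_k)
      finally show ?thesis by (simp flip: real_sqrt_power)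
    qed
    ultimately have "sqrt n * sqrt 2 ^ k \<le> sqrt B * sqrt B" by (intro mult_mono) (use B1 in auto)
    then have "sqrt n * sqrt 2 ^ k \<le> B" using B1 by simp
    moreover have "sqrt n * sqrt 2 ^ k > 0" using n by simp
    ultimately have "1 / B \<le> 1 / (sqrt n * sqrt 2 ^ k)" by (intro divide_left_mono) (use B1 in auto)
    also have "\<dots> = sqrt (1/2) ^ k / sqrt n" by (simp add: real_sqrt_divide power_divide)
    finally have "1 / B \<le> sqrt (1/2) ^ k / sqrt n" .
    with 1 have "x ^ 2 * (1 / B) \<le> exp (4 * sqrt k) * (sqrt (1/2) ^ k / sqrt n)"
      by (intro mult_mono) (use B1 in auto)
    then show ?thesis by simp
  qed
  finally show ?thesis by (simp add: B_def)
qed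

lemma disconnected_vanishes:
  assumes r: "r \<ge> 2"
  shows "(\<lambda>n. (\<Sum>k\<in>{1..n div 2}. real (n choose k) * real (inj_count k k * inj_count (n - k) (n - k)) ^ r)
      / real (inj_count n n) ^ r) \<longlonglongrightarrow> 0"
proof -
  define h where "h = (\<lambda>k::nat. exp (4 * sqrt k) * sqrt (1/2) ^ k)"
  have h: "summable h"
  proof (rule summable_comparison_test_bigo)
    show "summable (\<lambda>k. norm (1 / real k ^ 2))"
      using inverse_power_summable[of 2, where ?'a = real] by (simp add: inverse_eq_divide)
    have "(\<lambda>k::nat. exp (4 * sqrt k) * exp (- (ln 2 / 2) * k)) \<in> O(\<lambda>k. 1 / real k ^ 2)"
      by real_asymp
    moreover have "sqrt (1/2) ^ k = exp (- (ln 2 / 2) * k)" for k :: nat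
      by (simp add: powr_half_sqrt[symmetric] powr_def exp_of_nat_mult[symmetric] ln_div)
    ultimately show "h \<in> O(\<lambda>k. 1 / real k ^ 2)" by (simp add: h_def)
  qed
  have h0: "h k \<ge> 0" for k by (simp add: h_def)
  show ?thesis
  proof (rule tendsto_sandwich)
    show "eventually (\<lambda>n. 0 \<le> (\<Sum>k\<in>{1..n div 2}. real (n choose k) * real (inj_count k k * inj_count (n - k) (n - k)) ^ r)
      / real (inj_count n n) ^ r) sequentially"
      by (intro always_eventually allI divide_nonneg_nonneg sum_nonneg mult_nonneg_nonneg) auto
    show "eventually (\<lambda>n. (\<Sum>k\<in>{1..n div 2}. real (n choose k) * real (inj_count k k * inj_count (n - k) (n - k)) ^ r)
      / real (inj_count n n) ^ r \<le> suminf h / sqrt (real n)) sequentially"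
      using eventually_ge_at_top[of 1]
    proof eventually_elim
      case (elim n)
      have "(\<Sum>k\<in>{1..n div 2}. real (n choose k) * real (inj_count k k * inj_count (n - k) (n - k)) ^ r)
          / real (inj_count n n) ^ r
        = (\<Sum>k\<in>{1..n div 2}. real (n choose k) * real (inj_count k k * inj_count (n - k) (n - k)) ^ r
          / real (inj_count n n) ^ r)"
        by (rule sum_divide_distrib)
      also have "\<dots> \<le> (\<Sum>k\<in>{1..n div 2}. h k / sqrt n)"
        unfolding h_def by (intro sum_mono disconnected_bound r elim)
      also have "\<dots> = (\<Sum>k\<in>{1..n div 2}. h k) / sqrt n" by (rule sum_divide_distrib[symmetric])
      also have "\<dots> \<le> suminf h / sqrt n"
        by (intro divide_right_mono sum_le_suminf h) (auto simp: h0)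
      finally show ?case .
    qed
    show "(\<lambda>n. suminf h / sqrt (real n)) \<longlonglongrightarrow> 0"
      by (rule real_tendsto_divide_at_top[OF tendsto_const]) real_asymp
  qed simp
qed

lemma inj_count_pos: "real (inj_count n n) > 0"
  using laguerre_ge_1[of n] unfolding inj_count_laguerre by (intro mult_pos_pos) auto

text \<open>A fixed vertex is avoided on both sides by a random partial injection with probability \<open>p \<le> 1 / n\<close>,
  and on one side with probability \<open>J n\<close>, which tends to \<open>0\<close>. Hence a leaf exists with probability at
  most \<open>2 * r * n * J n * p ^ (r - 1) \<le> 2 * r * J n\<close>, where \<open>r \<ge> 2\<close> is used.\<close>

lemma leaf_vanishes:
  assumes r: "r \<ge> 2"
  shows "(\<lambda>n. real (n * (r * (2 * inj_count n (n - 1) * inj_count (n - 1) (n - 1) ^ (r - 1))))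
      / real (inj_count n n) ^ r) \<longlonglongrightarrow> 0"
proof -
  define J where "J = (\<lambda>n. 1 - laguerre (n - 1) / laguerre n)"
  have "J \<longlonglongrightarrow> 1 - 1" unfolding J_def by (intro tendsto_intros laguerre_ratio)
  then have "(\<lambda>n. 2 * real r * J n) \<longlonglongrightarrow> 2 * real r * 0" by (intro tendsto_intros) simp
  then have lim: "(\<lambda>n. 2 * real r * J n) \<longlonglongrightarrow> 0" by simp
  have nonneg: "eventually (\<lambda>n. 0 \<le> real (n * (r * (2 * inj_count n (n - 1) * inj_count (n - 1) (n - 1) ^ (r - 1))))
      / real (inj_count n n) ^ r) sequentially"
    by simp
  have le: "eventually (\<lambda>n. real (n * (r * (2 * inj_count n (n - 1) * inj_count (n - 1) (n - 1) ^ (r - 1))))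
      / real (inj_count n n) ^ r \<le> 2 * real r * J n) sequentially"
    using eventually_ge_at_top[of 1]
  proof eventually_elim
    case (elim n)
    then obtain m where n: "n = Suc m" by (cases n) auto
    define I where "I = real (inj_count n n)"
    define p where "p = real (inj_count m m) / I"
    have I: "I > 0" unfolding I_def by (rule inj_count_pos)
    have lp: "laguerre k > 0" for k using laguerre_ge_1[of k] by linarith
    have p: "n * p = laguerre m / laguerre n"
    proof -
      have fact_n: "(fact n :: real) = n * fact m" by (simp add: n algebra_simps)
      show ?thesis using elim unfolding p_def I_def inj_count_laguerre fact_n by simp
    qed
    have "laguerre m / laguerre n \<le> 1" using lp laguerre_mono[of m n] by (simp add: n)
    then have np: "n * p \<le> 1" and J0: "J n \<ge> 0" using p by (auto simp: J_def n)
    have p0: "p \<ge> 0" using I by (simp add: p_def)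
    have "p * 1 \<le> p * n" using p0 elim by (intro mult_left_mono) auto
    then have p1: "p \<le> 1" using np by (simp add: mult.commute)
    have "real (inj_count n m) + real n * real (inj_count m m) = I"
      using inj_count_step[of m] unfolding I_def n by (metis of_nat_add of_nat_mult)
    then have J: "real (inj_count n m) / I = J n"
      using p I unfolding J_def p_def n by (simp add: field_simps)
    obtain d where d: "r = Suc (Suc d)" using r by (metis add_2_eq_Suc le_Suc_ex)
    have "real (n * (r * (2 * inj_count n (n - 1) * inj_count (n - 1) (n - 1) ^ (r - 1)))) / real (inj_count n n) ^ r
       = 2 * real r * (real (inj_count n m) / I) * (n * p ^ (r - 1))"
    proof -
      have nm: "n - 1 = m" and rd: "r - 1 = Suc d" using n d by auto
      have *: "a * (c * (2 * X * Y ^ Suc d)) / I ^ r = 2 * c * (X / I) * (a * (Y / I) ^ Suc d)" for a c X Y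
        unfolding d by (simp add: power_divide)
      show ?thesis
        unfolding p_def I_def[symmetric] nm rd of_nat_mult of_nat_power of_nat_numeral by (rule *)
    qed
    also have "\<dots> = 2 * real r * J n * ((n * p) * p ^ d)" by (simp only: J d) simp
    also have "\<dots> \<le> 2 * real r * J n * (1 * 1)"
      using np p0 p1 J0 by (intro mult_left_mono mult_mono power_le_one) auto
    finally show ?case by simp
  qed
  show ?thesis by (rule tendsto_sandwich[OF nonneg le tendsto_const lim])
qed

lemma rooted_graphs_ratio:
  assumes A: "finite A" and r: "card A \<ge> 2"
  shows "(\<lambda>n. real (card (rooted_graphs A n)) / real (inj_count n n) ^ card A) \<longlonglongrightarrow> 1"
proof -
  define D where "D = (\<lambda>n. (\<Sum>k\<in>{1..n div 2}. real (n choose k) * real (inj_count k k * inj_count (n - k) (n - k)) ^ card A)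
      / real (inj_count n n) ^ card A)"
  define L where "L = (\<lambda>n. real (n * (card A * (2 * inj_count n (n - 1) * inj_count (n - 1) (n - 1) ^ (card A - 1))))
      / real (inj_count n n) ^ card A)"
  have "A \<noteq> {}" using r by auto
  note bounds = rooted_graphs_bounds[OF A this]
  show ?thesis
  proof (rule tendsto_sandwich)
    show "eventually (\<lambda>n. 1 - D n - L n \<le> real (card (rooted_graphs A n)) / real (inj_count n n) ^ card A) sequentially"
      using eventually_ge_at_top[of 1]
    proof eventually_elim
      case (elim n)
      have I: "real (inj_count n n) ^ card A > 0" using inj_count_pos by simp
      from bounds(2)[OF elim, THEN of_nat_mono[where ?'a = real]]
      have "real (inj_count n n) ^ card A \<le> real (card (rooted_graphs A n))
        + (\<Sum>k\<in>{1..n div 2}. real (n choose k) * real (inj_count k k * inj_count (n - k) (n - k)) ^ card A)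
        + real (n * (card A * (2 * inj_count n (n - 1) * inj_count (n - 1) (n - 1) ^ (card A - 1))))"
        by simp
      then have "1 \<le> real (card (rooted_graphs A n)) / real (inj_count n n) ^ card A + D n + L n"
        unfolding D_def L_def add_divide_distrib[symmetric] by (subst le_divide_eq_1_pos[OF I])
      then show ?case by linarith
    qed
    show "eventually (\<lambda>n. real (card (rooted_graphs A n)) / real (inj_count n n) ^ card A \<le> 1) sequentially"
      using eventually_ge_at_top[of 1]
    proof eventually_elim
      case (elim n)
      from bounds(1)[OF elim, THEN of_nat_mono[where ?'a = real]] inj_count_pos[of n]
      show ?case by simp
    qed
    have "(\<lambda>n. 1 - D n - L n) \<longlonglongrightarrow> 1 - 0 - 0"
      unfolding D_def L_def by (intro tendsto_diff tendsto_const disconnected_vanishes leaf_vanishes r)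
    then show "(\<lambda>n. 1 - D n - L n) \<longlonglongrightarrow> 1" by simp
  qed simp
qed

text \<open>Stirling's formula for \<open>fact n\<close> combined with the asymptotics of \<open>laguerre n\<close>: the quantity equals
  \<open>fact n ^ (r - 1) * n * laguerre n ^ r\<close>.\<close>

lemma inj_count_power_asymp:
  assumes r: "r \<ge> 1"
  shows "(\<lambda>n. real (inj_count n n) ^ r / fact (n - 1)) \<sim>[at_top]
     (\<lambda>n. (2 * exp 1) powr (- (real r / 2)) / sqrt (2 * pi)
              * exp (- ((real r - 1) * real n) + 2 * real r * sqrt (real n))
              * real n powr ((real r - 1) * real n + (real r + 2) / 4))"
    (is "?F \<sim>[at_top] (\<lambda>n. ?C * ?e n * ?p n)")
proof -
  obtain m where m: "r = Suc m" using r by (cases r) auto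
  define K :: real where "K = exp (-1/2) / (2 * sqrt pi)"
  define s where "s = (\<lambda>n. fact n / (sqrt n * (n / exp 1) ^ n) :: real)"
  define q where "q = (\<lambda>n. laguerre n * n powr (1/4) / exp (2 * sqrt n))"
  have "sqrt (2 * pi) * K = 1 / sqrt (2 * exp 1)"
  proof -
    have "exp (1/2 :: real) = sqrt (exp 1)" by (rule real_sqrt_unique[symmetric]) (auto simp flip: exp_of_nat_mult)
    then show ?thesis
      by (simp add: K_def exp_minus real_sqrt_mult field_simps)
  qed
  moreover have "a ^ m * b ^ r = (a * b) ^ r / a" if "a \<noteq> 0" for a b :: real
    using that by (simp add: m power_mult_distrib)
  ultimately have "sqrt (2 * pi) ^ m * K ^ r = (1 / sqrt (2 * exp 1)) ^ r / sqrt (2 * pi)"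
    by simp
  also have "(1 / sqrt (2 * exp 1)) ^ r = (2 * exp 1 :: real) powr (- (real r / 2))"
  proof -
    have "1 / sqrt (2 * exp 1) = (2 * exp 1 :: real) powr (- (1/2))"
      by (simp add: powr_minus powr_half_sqrt inverse_eq_divide)
    then show ?thesis by (simp add: powr_power mult.commute)
  qed
  finally have C: "sqrt (2 * pi) ^ m * K ^ r = ?C" by simp
  have C0: "?C > 0" by simp
  have eq: "?F n / (?C * ?e n * ?p n) = s n ^ m * q n ^ r / ?C" if "n \<ge> 1" for n
  proof -
    have n: "real n > 0" using that by simp
    have e: "?e n = exp (2 * sqrt n) ^ r / exp n ^ m"
      by (simp add: exp_diff exp_of_nat_mult[symmetric] exp_add exp_minus m field_simps)
    have p: "?p n = (real n ^ n) ^ m * (sqrt n ^ m * n / (n powr (1/4)) ^ r)"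
    proof -
      have "real n ^ n = n powr n" using n by (simp add: powr_realpow)
      moreover have "sqrt n = n powr (1/2)" by (simp add: powr_half_sqrt)
      ultimately have "(real n ^ n) ^ m * (sqrt n ^ m * n / (n powr (1/4)) ^ r)
         = n powr (n * m) * (n powr (1/2 * m) * n powr 1 / n powr (1/4 * r))"
        using n by (simp add: powr_power mult_ac)
      also have "\<dots> = n powr (n * m + (1/2 * m + 1 - 1/4 * r))"
        by (simp add: powr_add powr_diff)
      also have "real (n * m) + (1/2 * m + 1 - 1/4 * r) = (real r - 1) * real n + (real r + 2) / 4"
        by (simp add: m field_simps)
      finally show ?thesis ..
    qed
    have f: "fact n = s n * (sqrt n * real n ^ n / exp n)"
      using n by (simp add: s_def power_divide exp_of_nat_mult[symmetric])
    have l: "laguerre n = q n * (exp (2 * sqrt n) / n powr (1/4))"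
      using n by (simp add: q_def)
    have "?F n = fact n ^ m * real n * laguerre n ^ r"
    proof -
      have "fact n = real n * fact (n - 1)" using that by (simp add: fact_reduce)
      then have "real n = fact n / fact (n - 1)" by simp
      then show ?thesis unfolding inj_count_laguerre by (simp add: m power_mult_distrib)
    qed
    also have "\<dots> = s n ^ m * q n ^ r * (?e n * ?p n)"
      unfolding e p l by (subst f) (simp add: power_mult_distrib power_divide)
    finally have "?F n = s n ^ m * q n ^ r * (?e n * ?p n)" .
    moreover have "?e n * ?p n \<noteq> 0" using n by simp
    moreover have "a * b / (c * e * p) = a / c" if "b = e * p" "b \<noteq> 0" for a b c e p :: real
      using that by auto
    ultimately show ?thesis by metis
  qed
  have "(\<lambda>n. s n ^ m * q n ^ r / ?C) \<longlonglongrightarrow> sqrt (2 * pi) ^ m * K ^ r / ?C"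
    unfolding s_def q_def K_def using C0 by (intro tendsto_intros stirling laguerre_asymp) simp
  also have "sqrt (2 * pi) ^ m * K ^ r / ?C = 1" unfolding C using C0 by simp
  finally have "(\<lambda>n. s n ^ m * q n ^ r / ?C) \<longlonglongrightarrow> 1" .
  moreover have "eventually (\<lambda>n. s n ^ m * q n ^ r / ?C = ?F n / (?C * ?e n * ?p n)) sequentially"
    using eventually_ge_at_top[of 1] by eventually_elim (rule eq[symmetric])
  ultimately have "(\<lambda>n. ?F n / (?C * ?e n * ?p n)) \<longlonglongrightarrow> 1" by (rule Lim_transform_eventually)
  then show ?thesis by (rule asymp_equivI')
qed

section \<open>The asymptotic number of subgroups\<close>

theorem mainTheorem2:
  fixes A :: "'a set" and r :: nat
  assumes "finite A" and "card A = r" and "r \<ge> 2"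
  shows "(\<lambda>n. real (num_subgroups A n)) \<sim>[at_top]
           (\<lambda>n. real (num_partial_inj n) ^ r / fact (n - 1))
       \<and> (\<lambda>n. real (num_subgroups A n)) \<sim>[at_top]
           (\<lambda>n. (2 * exp 1) powr (- (real r / 2)) / sqrt (2 * pi)
              * exp (- ((real r - 1) * real n) + 2 * real r * sqrt (real n))
              * real n powr ((real r - 1) * real n + (real r + 2) / 4))"
proof -
  have "(\<lambda>n. real (num_subgroups A n)) \<sim>[at_top] (\<lambda>n. real (num_partial_inj n) ^ r / fact (n - 1))"
  proof (rule asymp_equivI')
    have "(\<lambda>n. real (card (rooted_graphs A n)) / real (inj_count n n) ^ r) \<longlonglongrightarrow> 1"
      using rooted_graphs_ratio[OF assms(1)] assms by simp
    moreover have "eventually (\<lambda>n. real (card (rooted_graphs A n)) / real (inj_count n n) ^ r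
        = real (num_subgroups A n) / (real (num_partial_inj n) ^ r / fact (n - 1))) sequentially"
      using eventually_ge_at_top[of 1]
      by eventually_elim (simp add: card_rooted_graphs[OF assms(1)] num_partial_inj_eq)
    ultimately show "(\<lambda>n. real (num_subgroups A n) / (real (num_partial_inj n) ^ r / fact (n - 1))) \<longlonglongrightarrow> 1"
      by (rule Lim_transform_eventually)
  qed
  moreover from this have "(\<lambda>n. real (num_subgroups A n)) \<sim>[at_top]
           (\<lambda>n. (2 * exp 1) powr (- (real r / 2)) / sqrt (2 * pi)
              * exp (- ((real r - 1) * real n) + 2 * real r * sqrt (real n))
              * real n powr ((real r - 1) * real n + (real r + 2) / 4))"
    by (rule asymp_equiv_trans) (use inj_count_power_asymp[of r] assms in \<open>simp add: num_partial_inj_eq\<close>)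
  ultimately show ?thesis by blast
qed

end
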